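(* Let $m$ be a positive integer, $\varepsilon\in\{-1,+1\}$, $W=\mathbb{Z}_2\times D_{2m}$ acting on $\mathbb{R}^3$ with root system $R$, and $\kappa:R\to\mathbb{C}$ a function invariant on the $W$-orbits. Let $\mathfrak{SA}_m^{\varepsilon}$ be the associated dihedral Dunkl--Dirac symmetry algebra, with one-index symmetries $O_1,O_2,O_3$, two-index symmetries $O_{12},O_{31},O_{23}$, three-index symmetry $O_{123}$, and elements $\widetilde{\sigma}_0,\widetilde{\sigma}_j$ ($1\leq j\leq 2m$) of the group $\widetilde{W}^{\varepsilon}$, all as defined in the context. Then: (i) $O_{123}$ commutes with every element of $\mathfrak{SA}_m^{\varepsilon}$. (ii) The two-index symmetries satisfy $$[O_{12},O_{31}] = O_{23}+2O_1O_{123}+\varepsilon[O_2,O_3],$$ $$[O_{23},O_{12}] = O_{31}+2O_2O_{123}+\varepsilon[O_3,O_1],$$ $$[O_{31},O_{23}] = O_{12}+2O_3O_{123}+\varepsilon[O_1,O_2].$$ (iii) The elements of $\widetilde{W}^{\varepsilon}$ interact with the two-index symmetries as $$\widetilde{\sigma}_0O_{12}=O_{12}\widetilde{\sigma}_0,\qquad \widetilde{\sigma}_0O_{31}=-O_{31}\widetilde{\sigma}_0,\qquad \widetilde{\sigma}_0O_{23}=-O_{23}\widetilde{\sigma}_0,$$ $$\widetilde{\sigma}_jO_{12}=-O_{12}\widetilde{\sigma}_j,$$ $$\widetilde{\sigma}_jO_{31}=\bigl(\cos(2j\pi/m)\,O_{31}+\sin(2j\pi/m)\,O_{23}\bigr)\widetilde{\sigma}_j,$$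 $$\widetilde{\sigma}_jO_{23}=\bigl(-\cos(2j\pi/m)\,O_{31}+\sin(2j\pi/m)\,O_{23}\bigr)\widetilde{\sigma}_j.$$
   Context: Notation: $[a,b]=ab-ba$, $\{a,b\}=ab+ba$. $\mathbb{R}^3$ has coordinate vectors $\xi_1,\xi_2,\xi_3$ and canonical bilinear form $\langle-,-\rangle$. Put $\alpha_0=(0,0,1)$ and $\alpha_j=(\sin(j\pi/m),-\cos(j\pi/m),0)$ for $1\le j\le 2m$. The root system is $R=\{\alpha_0,-\alpha_0\}\cup\{\alpha_j: 1\le j\le 2m\}$, with positive roots $R_+=\{\alpha_0,\alpha_1,\dots,\alpha_m\}$. For $\alpha\in R$, the related reflection is $\sigma_\alpha(x)=x-2\frac{\langle x,\alpha\rangle}{\langle\alpha,\alpha\rangle}\alpha$, and $W=\mathbb{Z}_2\times D_{2m}$ ($D_{2m}$ the dihedral group of order $2m$) is the group generated by these reflections, acting on functions on $\mathbb{R}^3$ by $(wf)(x)=f(w^{-1}x)$. The function $\kappa:R\to\mathbb{C}$ is constant on $W$-orbits. Dunkl operators, acting on polynomials in $x_1,x_2,x_3$: $$\mathcal{D}_jf(x)=\partial_{x_j}f(x)+\sum_{\alpha\in R_+}\kappa(\alpha)\frac{f(x)-f(\sigma_\alpha(x))}{\langle x,\alpha\rangle}\langle\alpha,\xi_j\rangle .$$ $\mathcal{A}_\kappa$ is the associative algebra of operators generated by the $\mathcal{D}_j$, the multiplication operators $x_j$, and the group algebra $\mathbb{C}[W]$. $Cl^{\varepsilon}(3)$ is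 the Clifford algebra generated by $e_1,e_2,e_3$ subject to $\{e_j,e_k\}=2\varepsilon\delta_{jk}$. All elements below live in $\mathcal{A}_\kappa\otimes Cl^{\varepsilon}(3)$, where elements of the two factors commute and $\otimes$ is often omitted. For $\alpha\in R$ let $\widetilde{\sigma}_\alpha=\sigma_\alpha\otimes\sum_{j=1}^3\langle\alpha,\xi_j\rangle e_j$, and put $\widetilde{\sigma}_0=\widetilde{\sigma}_{\alpha_0}$, $\widetilde{\sigma}_j=\widetilde{\sigma}_{\alpha_j}$. These generate a group $\widetilde{W}^{\varepsilon}$, a central extension of $W$; $\mathbb{C}[\widetilde{W}^{\varepsilon}]$ denotes its group algebra as realised in $\mathcal{A}_\kappa\otimes Cl^{\varepsilon}(3)$. One-index symmetries: with the Dunkl--Dirac operator $\underline{\mathcal{D}}=\mathcal{D}_1e_1+\mathcal{D}_2e_2+\mathcal{D}_3e_3$, $$O_j=\frac{\varepsilon}{2}\bigl([\underline{\mathcal{D}},x_j]-e_j\bigr)=\frac{\varepsilon}{2}\Bigl(\sum_{k=1}^3e_k[\mathcal{D}_k,x_j]-e_j\Bigr).$$ Two-index symmetries: with $L_{ij}=x_i\mathcal{D}_j-x_j\mathcal{D}_i$, $$O_{ij}=L_{ij}+\frac{\varepsilon}{2}e_ie_j+O_ie_j-O_je_i=L_{ij}+\frac{\varepsilon}{2}e_ie_j+e_iO_j-e_jO_i.$$ Three-index symmetry: $$O_{123}=-\frac{\varepsilon}{2}e_1e_2e_3-O_1e_2e_3-O_2e_3e_1-O_3e_1e_2+O_{12}e_3+O_{31}e_2+O_{23}e_1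 .$$ The dihedral Dunkl--Dirac symmetry algebra $\mathfrak{SA}_m^{\varepsilon}$ is the associative subalgebra of $\mathcal{A}_\kappa\otimes Cl^{\varepsilon}(3)$ generated by $O_{12},O_{31},O_{23},O_{123}$ and $\mathbb{C}[\widetilde{W}^{\varepsilon}]$.
   Formalization: The last two relations of (iii) are false as printed (e.g. m=1, κ=0, j=1) and are corrected to σ̃_j O_31 = (cos(2jπ/m) O_31 − sin(2jπ/m) O_23) σ̃_j and σ̃_j O_23 = (−sin(2jπ/m) O_31 − cos(2jπ/m) O_23) σ̃_j. *)

theory Defs
  imports "HOL-Analysis.Analysis"
begin

section \<open>Complex polynomials on three-dimensional space\<close>

lemma polynomial_function_complex_iff:
  fixes f :: "'a::real_normed_vector \<Rightarrow> complex"
  shows "polynomial_function f \<longleftrightarrow>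
    real_polynomial_function (\<lambda>x. Re (f x)) \<and> real_polynomial_function (\<lambda>x. Im (f x))"
proof
  assume "polynomial_function f"
  then show "real_polynomial_function (\<lambda>x. Re (f x)) \<and> real_polynomial_function (\<lambda>x. Im (f x))"
    unfolding polynomial_function_def o_def using bounded_linear_Re bounded_linear_Im by blast
next
  assume *: "real_polynomial_function (\<lambda>x. Re (f x)) \<and> real_polynomial_function (\<lambda>x. Im (f x))"
  have "polynomial_function (\<lambda>x. Re (f x) *\<^sub>R 1 + Im (f x) *\<^sub>R \<i>)"
    using * by (intro polynomial_function_add polynomial_function_mult)
      (auto simp: real_polynomial_function_eq)
  also have "(\<lambda>x. Re (f x) *\<^sub>R 1 + Im (f x) *\<^sub>R \<i>) = f"
    by (auto simp: complex_eq_iff)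
  finally show "polynomial_function f" .
qed

lemma polynomial_function_times:
  fixes f g :: "'a::real_normed_vector \<Rightarrow> complex"
  assumes "polynomial_function f" "polynomial_function g"
  shows "polynomial_function (\<lambda>x. f x * g x)"
  using assms unfolding polynomial_function_complex_iff
  by (simp add: real_polynomial_function_diff real_polynomial_function.intros(3,4))

lemma polynomial_function_coord:
  "polynomial_function (\<lambda>x::real^3. complex_of_real (x $ j))"
  unfolding polynomial_function_complex_iff
  by (auto intro!: real_polynomial_function.intros bounded_linear_vec_nth)

text \<open>Over an infinite field polynomials and polynomial functions are the same thing.\<close>

typedef poly3 = "{f :: real^3 \<Rightarrow> complex. polynomial_function f}"
  morphisms peval Poly3
  by (rule exI[of _ "\<lambda>_. 0"]) simp

setup_lifting type_definition_poly3

instantiation poly3 :: comm_ring_1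
begin
lift_definition zero_poly3 :: poly3 is "\<lambda>_. 0" by simp
lift_definition one_poly3 :: poly3 is "\<lambda>_. 1" by simp
lift_definition plus_poly3 :: "poly3 \<Rightarrow> poly3 \<Rightarrow> poly3" is "\<lambda>f g x. f x + g x"
  by (rule polynomial_function_add)
lift_definition minus_poly3 :: "poly3 \<Rightarrow> poly3 \<Rightarrow> poly3" is "\<lambda>f g x. f x - g x"
  by (rule polynomial_function_diff)
lift_definition uminus_poly3 :: "poly3 \<Rightarrow> poly3" is "\<lambda>f x. - f x"
  by (rule polynomial_function_minus)
lift_definition times_poly3 :: "poly3 \<Rightarrow> poly3 \<Rightarrow> poly3" is "\<lambda>f g x. f x * g x"
  by (rule polynomial_function_times)
instance
  by standard (transfer; simp add: algebra_simps fun_eq_iff)+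
end

lift_definition pconst :: "complex \<Rightarrow> poly3" is "\<lambda>c x. c" by simp

lift_definition pvar :: "3 \<Rightarrow> poly3" is "\<lambda>j x. complex_of_real (x $ j)"
  by (rule polynomial_function_coord)

lemma poly3_eqI: "(\<And>x. peval p x = peval q x) \<Longrightarrow> p = q"
  by transfer auto

lemma peval_simps [simp]:
  "peval 0 x = 0" "peval 1 x = 1" "peval (p + q) x = peval p x + peval q x"
  "peval (p - q) x = peval p x - peval q x" "peval (- p) x = - peval p x"
  "peval (p * q) x = peval p x * peval q x"
  "peval (pconst c) x = c" "peval (pvar j) x = complex_of_real (x $ j)"
  by (transfer; simp)+


section \<open>The algebra of linear operators on polynomials\<close>

typedef lop = "{T :: poly3 \<Rightarrow> poly3.
    (\<forall>f g. T (f + g) = T f + T g) \<and> (\<forall>c f. T (pconst c * f) = pconst c * T f)}"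
  morphisms app Lop
  by (rule exI[of _ "\<lambda>f. f"]) simp

setup_lifting type_definition_lop

instantiation lop :: real_algebra_1
begin
lift_definition zero_lop :: lop is "\<lambda>_. 0" by simp
lift_definition one_lop :: lop is "\<lambda>f. f" by simp
lift_definition plus_lop :: "lop \<Rightarrow> lop \<Rightarrow> lop" is "\<lambda>S T f. S f + T f"
  by (simp add: algebra_simps)
lift_definition minus_lop :: "lop \<Rightarrow> lop \<Rightarrow> lop" is "\<lambda>S T f. S f - T f"
  by (simp add: algebra_simps)
lift_definition uminus_lop :: "lop \<Rightarrow> lop" is "\<lambda>T f. - T f"
  by (simp add: algebra_simps)
lift_definition times_lop :: "lop \<Rightarrow> lop \<Rightarrow> lop" is "\<lambda>S T f. S (T f)" by simp
lift_definition scaleR_lop :: "real \<Rightarrow> lop \<Rightarrow> lop" is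
  "\<lambda>r T f. pconst (of_real r) * T f"
  by (simp add: algebra_simps)

lemma lop_eqI: "(\<And>f. app S f = app T f) \<Longrightarrow> S = T"
  by transfer auto

lemma app_simps [simp]:
  "app 0 f = 0" "app 1 f = f" "app (S + T) f = app S f + app T f"
  "app (S - T) f = app S f - app T f" "app (- T) f = - app T f"
  "app (S * T) f = app S (app T f)" "app (r *\<^sub>R T) f = pconst (of_real r) * app T f"
  by (simp_all add: zero_lop.rep_eq one_lop.rep_eq plus_lop.rep_eq minus_lop.rep_eq
      uminus_lop.rep_eq times_lop.rep_eq scaleR_lop.rep_eq)

lemma app_linear [simp]:
  "app T (f + g) = app T f + app T g" "app T (pconst c * f) = pconst c * app T f"
  using app[of T] by auto

instance
proof
  have padd: "pconst (of_real (a + b)) = pconst (of_real a) + pconst (of_real b)"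
    and pmul: "pconst (of_real (a * b)) = pconst (of_real a) * pconst (of_real b)"
    and pone: "pconst (of_real 1) = 1" for a b :: real
    by (rule poly3_eqI, simp)+
  fix a b :: real and R S T :: lop
  show "R + S + T = R + (S + T)" "R + S = S + R" "0 + R = R" "- R + R = 0" "R - S = R + - S"
    "R * S * T = R * (S * T)" "(R + S) * T = R * T + S * T" "R * (S + T) = R * S + R * T"
    "1 * R = R" "R * 1 = R" "a *\<^sub>R R * S = a *\<^sub>R (R * S)" "R * a *\<^sub>R S = a *\<^sub>R (R * S)"
    by (rule lop_eqI, simp add: add.assoc add.commute)+
  show "a *\<^sub>R (R + S) = a *\<^sub>R R + a *\<^sub>R S"
    by (rule lop_eqI) (simp add: distrib_left)
  show "(a + b) *\<^sub>R R = a *\<^sub>R R + b *\<^sub>R R"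
    by (rule lop_eqI) (simp only: app_simps padd distrib_right)
  show "a *\<^sub>R b *\<^sub>R R = (a * b) *\<^sub>R R"
    by (rule lop_eqI) (simp only: app_simps pmul mult.assoc)
  show "1 *\<^sub>R R = R"
    by (rule lop_eqI) (simp only: app_simps pone mult_1_left)
  have "peval (app (0::lop) 1) 0 \<noteq> peval (app 1 1) 0"
    by simp
  then show "(0::lop) \<noteq> 1"
    by metis
qed
end

lift_definition scaleC_lop :: "complex \<Rightarrow> lop \<Rightarrow> lop" is "\<lambda>c T f. pconst c * T f"
  by (simp add: algebra_simps)

lemma app_scaleC [simp]: "app (scaleC_lop c T) f = pconst c * app T f"
  by (simp add: scaleC_lop.rep_eq)

lemma app_sum [simp]: "app (\<Sum>i\<in>I. T i) f = (\<Sum>i\<in>I. app (T i) f)"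
  by (induction I rule: infinite_finite_induct) auto

lemma peval_sum [simp]: "peval (\<Sum>i\<in>I. p i) x = (\<Sum>i\<in>I. peval (p i) x)"
  by (induction I rule: infinite_finite_induct) auto


subsection \<open>Multiplication operators and partial derivatives\<close>

lift_definition mult_var :: "3 \<Rightarrow> lop" is "\<lambda>j f. pvar j * f"
  by (simp add: algebra_simps)

lemma real_polynomial_directional_derivative:
  assumes "real_polynomial_function f"
  shows "\<exists>g. real_polynomial_function g \<and>
    (\<forall>x. ((\<lambda>t. f (x + t *\<^sub>R u)) has_real_derivative g x) (at 0))"
  using assms
proof induction
  case (linear f)
  then have lf: "linear f"
    by (rule bounded_linear.linear)
  have "((\<lambda>t. f (x + t *\<^sub>R u)) has_real_derivative f u) (at 0)" for x
    unfolding linear_add[OF lf] linear_scale[OF lf] by (auto intro!: derivative_eq_intros)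
  then show ?case
    by (intro exI[of _ "\<lambda>_. f u"]) auto
next
  case (const c)
  then show ?case
    by (intro exI[of _ "\<lambda>_. 0"]) auto
next
  case (add f g)
  then obtain f' g' where "real_polynomial_function f'" "real_polynomial_function g'"
    "\<And>x. ((\<lambda>t. f (x + t *\<^sub>R u)) has_real_derivative f' x) (at 0)"
    "\<And>x. ((\<lambda>t. g (x + t *\<^sub>R u)) has_real_derivative g' x) (at 0)"
    by blast
  then show ?case
    by (intro exI[of _ "\<lambda>x. f' x + g' x"]) (auto intro!: derivative_intros)
next
  case (mult f g)
  then obtain f' g' where *: "real_polynomial_function f'" "real_polynomial_function g'"
    "\<And>x. ((\<lambda>t. f (x + t *\<^sub>R u)) has_real_derivative f' x) (at 0)"
    "\<And>x. ((\<lambda>t. g (x + t *\<^sub>R u)) has_real_derivative g' x) (at 0)"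
    by blast
  have "((\<lambda>t. f (x + t *\<^sub>R u) * g (x + t *\<^sub>R u)) has_real_derivative
      (f' x * g x + g' x * f x)) (at 0)" for x
    using DERIV_mult[OF *(3)[of x] *(4)[of x]] by simp
  with mult * show ?case
    by (intro exI[of _ "\<lambda>x. f' x * g x + g' x * f x"]) auto
qed

lemma polynomial_directional_derivative:
  fixes f :: "'a::real_normed_vector \<Rightarrow> complex"
  assumes "polynomial_function f"
  shows "\<exists>g. polynomial_function g \<and>
    (\<forall>x. ((\<lambda>t. f (x + t *\<^sub>R u)) has_vector_derivative g x) (at 0))"
proof -
  obtain a b where ab: "real_polynomial_function a" "real_polynomial_function b"
    "\<And>x. ((\<lambda>t. Re (f (x + t *\<^sub>R u))) has_real_derivative a x) (at 0)"
    "\<And>x. ((\<lambda>t. Im (f (x + t *\<^sub>R u))) has_real_derivative b x) (at 0)"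
    using assms real_polynomial_directional_derivative[of "\<lambda>x. Re (f x)" u]
      real_polynomial_directional_derivative[of "\<lambda>x. Im (f x)" u]
    unfolding polynomial_function_complex_iff by blast
  have "((\<lambda>t. f (x + t *\<^sub>R u)) has_vector_derivative Complex (a x) (b x)) (at 0)" for x
    using ab(3,4)[of x] by (simp add: has_vector_derivative_complex_iff)
  moreover have "polynomial_function (\<lambda>x. Complex (a x) (b x))"
    using ab by (simp add: polynomial_function_complex_iff)
  ultimately show ?thesis
    by blast
qed

lift_definition partial_deriv :: "3 \<Rightarrow> poly3 \<Rightarrow> poly3" is
  "\<lambda>j f x. vector_derivative (\<lambda>t. f (x + t *\<^sub>R axis j 1)) (at 0)"
proof -
  fix j :: 3 and f :: "real^3 \<Rightarrow> complex"
  assume f: "polynomial_function f"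
  obtain g where g: "polynomial_function g \<and>
      (\<forall>x. ((\<lambda>t. f (x + t *\<^sub>R axis j 1)) has_vector_derivative g x) (at 0))"
    using polynomial_directional_derivative[OF f] by (rule exE)
  then have "(\<lambda>x. vector_derivative (\<lambda>t. f (x + t *\<^sub>R axis j 1)) (at 0)) = g"
    by (intro ext vector_derivative_at) (rule conjunct2[THEN spec])
  with g show "polynomial_function (\<lambda>x. vector_derivative (\<lambda>t. f (x + t *\<^sub>R axis j 1)) (at 0))"
    by (simp only:)
qed

lemma partial_deriv_has_vector_derivative:
  "((\<lambda>t. peval f (x + t *\<^sub>R axis j 1)) has_vector_derivative peval (partial_deriv j f) x) (at 0)"
proof transfer
  fix f :: "real^3 \<Rightarrow> complex" and x :: "real^3" and j :: 3
  assume f: "polynomial_function f"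
  obtain g where "polynomial_function g \<and>
      (\<forall>x. ((\<lambda>t. f (x + t *\<^sub>R axis j 1)) has_vector_derivative g x) (at 0))"
    using polynomial_directional_derivative[OF f] by (rule exE)
  then have "((\<lambda>t. f (x + t *\<^sub>R axis j 1)) has_vector_derivative g x) (at 0)"
    by (rule conjunct2[THEN spec])
  then show "((\<lambda>t. f (x + t *\<^sub>R axis j 1)) has_vector_derivative
      vector_derivative (\<lambda>t. f (x + t *\<^sub>R axis j 1)) (at 0)) (at 0)"
    by (simp only: vector_derivative_at)
qed

lemma partial_deriv_eqI:
  assumes "\<And>x. ((\<lambda>t. peval f (x + t *\<^sub>R axis j 1)) has_vector_derivative peval g x) (at 0)"
  shows "partial_deriv j f = g"
  by (rule poly3_eqI)
    (rule vector_derivative_unique_at[OF partial_deriv_has_vector_derivative assms])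

lift_definition deriv_op :: "3 \<Rightarrow> lop" is partial_deriv
proof (intro conjI allI)
  fix j :: 3 and f g :: poly3 and c :: complex
  show "partial_deriv j (f + g) = partial_deriv j f + partial_deriv j g"
    by (rule partial_deriv_eqI)
      (auto intro!: derivative_eq_intros partial_deriv_has_vector_derivative)
  show "partial_deriv j (pconst c * f) = pconst c * partial_deriv j f"
    by (rule partial_deriv_eqI)
      (auto intro!: has_vector_derivative_mult_right partial_deriv_has_vector_derivative)
qed


subsection \<open>Reflections and divided differences\<close>

definition reflection :: "real^3 \<Rightarrow> real^3 \<Rightarrow> real^3" where
  "reflection \<alpha> x = x - (2 * (x \<bullet> \<alpha>) / (\<alpha> \<bullet> \<alpha>)) *\<^sub>R \<alpha>"

lemma linear_reflection: "linear (reflection \<alpha>)"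
  unfolding reflection_def by (rule linearI) (simp_all add: algebra_simps inner_add_left add_divide_distrib)

lemma polynomial_function_compose_reflection:
  fixes f :: "real^3 \<Rightarrow> complex"
  assumes "polynomial_function f"
  shows "polynomial_function (\<lambda>x. f (reflection \<alpha> x))"
proof -
  have "polynomial_function (reflection \<alpha>)"
    using linear_reflection linear_conv_bounded_linear polynomial_function_bounded_linear by blast
  then show ?thesis
    using assms real_polynomial_function_compose[of "reflection \<alpha>"]
    unfolding polynomial_function_complex_iff o_def by blast
qed

lift_definition pcomp_reflection :: "real^3 \<Rightarrow> poly3 \<Rightarrow> poly3" is "\<lambda>\<alpha> f x. f (reflection \<alpha> x)"
  by (rule polynomial_function_compose_reflection)

lemma peval_pcomp_reflection [simp]: "peval (pcomp_reflection \<alpha> f) x = peval f (reflection \<alpha> x)"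
  by transfer simp

text \<open>The action of a reflection on functions; reflections are their own inverses.\<close>

lift_definition reflection_op :: "real^3 \<Rightarrow> lop" is pcomp_reflection
  by (auto intro!: poly3_eqI)

lemma real_polynomial_divided_difference:
  fixes f :: "real^3 \<Rightarrow> real"
  assumes "real_polynomial_function f"
  shows "\<exists>q. real_polynomial_function q \<and> (\<forall>x. f x - f (reflection \<alpha> x) = (x \<bullet> \<alpha>) * q x)"
  using assms
proof induction
  case (linear f)
  then have lf: "linear f"
    by (rule bounded_linear.linear)
  then show ?case
    by (intro exI[of _ "\<lambda>_. 2 * f \<alpha> / (\<alpha> \<bullet> \<alpha>)"])
      (auto simp: reflection_def linear_diff[OF lf] linear_scale[OF lf])
next
  case (const c)
  then show ?case
    by (intro exI[of _ "\<lambda>_. 0"]) auto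
next
  case (add f g)
  obtain p where p: "real_polynomial_function p \<and> (\<forall>x. f x - f (reflection \<alpha> x) = (x \<bullet> \<alpha>) * p x)"
    using add.IH(1) by (rule exE)
  obtain q where q: "real_polynomial_function q \<and> (\<forall>x. g x - g (reflection \<alpha> x) = (x \<bullet> \<alpha>) * q x)"
    using add.IH(2) by (rule exE)
  have "f x + g x - (f (reflection \<alpha> x) + g (reflection \<alpha> x)) = (x \<bullet> \<alpha>) * (p x + q x)" for x
    using p q by (simp add: distrib_left add_diff_add)
  moreover have "real_polynomial_function (\<lambda>x. p x + q x)"
    using p q by (simp add: real_polynomial_function.intros(3))
  ultimately show ?case
    by (intro exI[of _ "\<lambda>x. p x + q x"]) simp
next
  case (mult f g)
  obtain p where p: "real_polynomial_function p \<and> (\<forall>x. f x - f (reflection \<alpha> x) = (x \<bullet> \<alpha>) * p x)"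
    using mult.IH(1) by (rule exE)
  obtain q where q: "real_polynomial_function q \<and> (\<forall>x. g x - g (reflection \<alpha> x) = (x \<bullet> \<alpha>) * q x)"
    using mult.IH(2) by (rule exE)
  have "real_polynomial_function (\<lambda>x. f (reflection \<alpha> x))"
    using real_polynomial_function_compose[of "reflection \<alpha>" f] mult(1) linear_reflection
      linear_conv_bounded_linear polynomial_function_bounded_linear
    unfolding o_def by blast
  moreover have "f x * g x - f (reflection \<alpha> x) * g (reflection \<alpha> x) =
      (x \<bullet> \<alpha>) * (p x * g x + f (reflection \<alpha> x) * q x)" for x
  proof -
    have "f x * g x - f (reflection \<alpha> x) * g (reflection \<alpha> x) =
        (f x - f (reflection \<alpha> x)) * g x + f (reflection \<alpha> x) * (g x - g (reflection \<alpha> x))"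
      by (simp add: algebra_simps)
    also have "f x - f (reflection \<alpha> x) = (x \<bullet> \<alpha>) * p x"
      using p by (rule conjunct2[THEN spec])
    also have "g x - g (reflection \<alpha> x) = (x \<bullet> \<alpha>) * q x"
      using q by (rule conjunct2[THEN spec])
    finally show ?thesis
      by (simp only: distrib_left mult_ac)
  qed
  moreover from calculation(1) have "real_polynomial_function (\<lambda>x. p x * g x + f (reflection \<alpha> x) * q x)"
    using mult.hyps p q by (simp add: real_polynomial_function.intros(3,4))
  ultimately show ?case
    by (intro exI[of _ "\<lambda>x. p x * g x + f (reflection \<alpha> x) * q x"]) simp
qed

lemma divided_difference_exists:
  "\<exists>q. \<forall>x. peval f x - peval f (reflection \<alpha> x) = of_real (x \<bullet> \<alpha>) * peval q x"
proof transfer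
  fix f :: "real^3 \<Rightarrow> complex" and \<alpha> :: "real^3"
  assume "polynomial_function f"
  then obtain a b where ab: "real_polynomial_function a" "real_polynomial_function b"
    "\<And>x. Re (f x) - Re (f (reflection \<alpha> x)) = (x \<bullet> \<alpha>) * a x"
    "\<And>x. Im (f x) - Im (f (reflection \<alpha> x)) = (x \<bullet> \<alpha>) * b x"
    using real_polynomial_divided_difference[of "\<lambda>x. Re (f x)" \<alpha>]
      real_polynomial_divided_difference[of "\<lambda>x. Im (f x)" \<alpha>]
    unfolding polynomial_function_complex_iff by blast
  then have "polynomial_function (\<lambda>x. Complex (a x) (b x))"
    by (simp add: polynomial_function_complex_iff)
  then show "\<exists>q\<in>{f. polynomial_function f}.
      \<forall>x. f x - f (reflection \<alpha> x) = of_real (x \<bullet> \<alpha>) * q x"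
    using ab by (intro bexI[of _ "\<lambda>x. Complex (a x) (b x)"]) (auto simp: complex_eq_iff)
qed

lemma poly3_eq_off_hyperplane:
  assumes "\<alpha> \<noteq> 0" and eq: "\<And>x. x \<bullet> \<alpha> \<noteq> 0 \<Longrightarrow> peval p x = peval q x"
  shows "p = q"
proof (rule poly3_eqI)
  fix x
  show "peval p x = peval q x"
  proof (cases "x \<bullet> \<alpha> = 0")
    case True
    have cont: "continuous_on UNIV (peval r)" for r
      by transfer (auto intro: continuous_on_polymonial_function)
    have "isCont (\<lambda>t. peval p (x + t *\<^sub>R \<alpha>) - peval q (x + t *\<^sub>R \<alpha>)) (0::real)"
      by (intro continuous_intros continuous_at_compose[unfolded o_def, of _ "\<lambda>t. x + t *\<^sub>R \<alpha>"])
        (use cont continuous_on_eq_continuous_at open_UNIV in blast)+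
    moreover have "peval p (x + t *\<^sub>R \<alpha>) - peval q (x + t *\<^sub>R \<alpha>) = 0" if "t \<noteq> 0" for t
      using True that assms(1) by (simp add: inner_add_left eq)
    ultimately have "((\<lambda>t::real. 0::complex) \<longlongrightarrow> peval p x - peval q x) (at 0)"
      unfolding isCont_def by (rule_tac Lim_transform_eventually) (auto simp: eventually_at_filter)
    then show ?thesis
      by (simp add: tendsto_const_iff)
  qed (rule eq)
qed

text \<open>
  The divided difference \<open>(f(x) - f(\<sigma>\<^sub>\<alpha>(x))) / \<langle>x,\<alpha>\<rangle>\<close> as a polynomial. A pointwise
  quotient would take the wrong value \<open>0\<close> on the hyperplane \<open>\<langle>x,\<alpha>\<rangle> = 0\<close>.
\<close>

definition divided_difference :: "real^3 \<Rightarrow> poly3 \<Rightarrow> poly3" where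
  "divided_difference \<alpha> f =
    (THE q. \<forall>x. x \<bullet> \<alpha> \<noteq> 0 \<longrightarrow> peval q x = (peval f x - peval f (reflection \<alpha> x)) / of_real (x \<bullet> \<alpha>))"

lemma divided_difference_eqI:
  assumes "\<alpha> \<noteq> 0"
    and "\<And>x. x \<bullet> \<alpha> \<noteq> 0 \<Longrightarrow> peval q x = (peval f x - peval f (reflection \<alpha> x)) / of_real (x \<bullet> \<alpha>)"
  shows "divided_difference \<alpha> f = q"
  unfolding divided_difference_def
  by (rule the_equality) (use assms in \<open>auto intro!: poly3_eq_off_hyperplane[of \<alpha>]\<close>)

lemma peval_divided_difference:
  assumes "x \<bullet> \<alpha> \<noteq> 0"
  shows "peval (divided_difference \<alpha> f) x =
    (peval f x - peval f (reflection \<alpha> x)) / of_real (x \<bullet> \<alpha>)"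
proof -
  obtain q where q: "\<And>x. peval f x - peval f (reflection \<alpha> x) = of_real (x \<bullet> \<alpha>) * peval q x"
    using divided_difference_exists by blast
  have "divided_difference \<alpha> f = q"
    using assms by (intro divided_difference_eqI) (auto simp: q)
  then show ?thesis
    using assms by (simp add: q)
qed

text \<open>Only nonzero \<open>\<alpha>\<close> matter; the zero vector needs a default value to obtain a linear operator.\<close>

lift_definition divided_difference_op :: "real^3 \<Rightarrow> lop" is
  "\<lambda>\<alpha> f. if \<alpha> = 0 then 0 else divided_difference \<alpha> f"
proof (intro conjI allI)
  fix \<alpha> :: "real^3" and f g :: poly3 and c :: complex
  show "(if \<alpha> = 0 then 0 else divided_difference \<alpha> (f + g)) =
      (if \<alpha> = 0 then 0 else divided_difference \<alpha> f) + (if \<alpha> = 0 then 0 else divided_difference \<alpha> g)"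
    by (auto intro!: divided_difference_eqI simp: peval_divided_difference diff_divide_distrib
        add_divide_distrib)
  show "(if \<alpha> = 0 then 0 else divided_difference \<alpha> (pconst c * f)) =
      pconst c * (if \<alpha> = 0 then 0 else divided_difference \<alpha> f)"
    by (auto intro!: divided_difference_eqI simp: peval_divided_difference algebra_simps
        diff_divide_distrib)
qed


section \<open>The root system and the Dunkl operators\<close>

definition dih_root0 :: "real^3" where
  "dih_root0 = vector [0, 0, 1]"

definition dih_root :: "nat \<Rightarrow> nat \<Rightarrow> real^3" where
  "dih_root m j = vector [sin (real j * pi / real m), - cos (real j * pi / real m), 0]"

definition dih_roots :: "nat \<Rightarrow> (real^3) set" where
  "dih_roots m = {dih_root0, - dih_root0} \<union> dih_root m ` {1..2 * m}"

definition pos_roots :: "nat \<Rightarrow> (real^3) set" where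
  "pos_roots m = {dih_root0} \<union> dih_root m ` {1..m}"

text \<open>Reflections are involutions, so closing under products with them gives a group.\<close>

inductive_set reflection_group :: "nat \<Rightarrow> (real^3 \<Rightarrow> real^3) set" for m where
  one: "id \<in> reflection_group m"
| mult: "w \<in> reflection_group m \<Longrightarrow> \<alpha> \<in> dih_roots m \<Longrightarrow> reflection \<alpha> \<circ> w \<in> reflection_group m"

definition orbit_invariant :: "nat \<Rightarrow> (real^3 \<Rightarrow> complex) \<Rightarrow> bool" where
  "orbit_invariant m \<kappa> \<longleftrightarrow> (\<forall>w\<in>reflection_group m. \<forall>\<alpha>\<in>dih_roots m. \<kappa> (w \<alpha>) = \<kappa> \<alpha>)"

definition dunkl :: "nat \<Rightarrow> (real^3 \<Rightarrow> complex) \<Rightarrow> 3 \<Rightarrow> lop" where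
  "dunkl m \<kappa> j = deriv_op j +
    (\<Sum>\<alpha>\<in>pos_roots m. scaleC_lop (\<kappa> \<alpha> * of_real (\<alpha> \<bullet> axis j 1)) (divided_difference_op \<alpha>))"

lemma peval_dunkl:
  assumes "\<And>\<alpha>. \<alpha> \<in> pos_roots m \<Longrightarrow> x \<bullet> \<alpha> \<noteq> 0"
  shows "peval (app (dunkl m \<kappa> j) f) x = peval (partial_deriv j f) x +
    (\<Sum>\<alpha>\<in>pos_roots m. \<kappa> \<alpha> * ((peval f x - peval f (reflection \<alpha> x)) / of_real (x \<bullet> \<alpha>)) *
       of_real (\<alpha> \<bullet> axis j 1))"
proof -
  have "app (divided_difference_op \<alpha>) f = divided_difference \<alpha> f" if "\<alpha> \<noteq> 0" for \<alpha>
    using that by transfer simp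
  moreover have "app (deriv_op j) f = partial_deriv j f"
    by transfer simp
  moreover have "\<alpha> \<noteq> 0" if "\<alpha> \<in> pos_roots m" for \<alpha>
    using assms[OF that] by auto
  ultimately show ?thesis
    using assms by (auto simp: dunkl_def peval_divided_difference intro!: sum.cong)
qed


section \<open>Tensor product with the Clifford algebra\<close>

text \<open>
  For an algebra \<open>A\<close>, the tensor product of \<open>A\<close> with the Clifford algebra on \<open>e\<^sub>1, e\<^sub>2, e\<^sub>3\<close>
  with \<open>{e\<^sub>j, e\<^sub>k} = 2 \<epsilon> \<delta>\<^sub>j\<^sub>k\<close> is the free \<open>A\<close>-module on the ordered monomials
  \<open>e\<^sub>S\<close> for \<open>S \<subseteq> {1, 2, 3}\<close>; an element is the vector of its coefficients in \<open>A\<close>.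
  One has \<open>e\<^sub>S e\<^sub>T = cl_sign \<epsilon> S T e\<^sub>S\<^sub>\<triangle>\<^sub>T\<close>: moving the factors of \<open>e\<^sub>T\<close> into
  place costs a sign for every inversion, and every repeated factor contributes
  \<open>e\<^sub>j\<^sup>2 = \<epsilon>\<close>. The order used on the type \<^typ>\<open>3\<close> has \<open>3 = 0 < 1 < 2\<close>; another
  order would only change the signs of the basis elements \<open>e\<^sub>S\<close>.
  The componentwise product and unit of the type of vectors are not used.
\<close>

definition cl_sign :: "real \<Rightarrow> 3 set \<Rightarrow> 3 set \<Rightarrow> real" where
  "cl_sign \<epsilon> S T = (-1) ^ card {(s, t). s \<in> S \<and> t \<in> T \<and> t < s} * \<epsilon> ^ card (S \<inter> T)"

definition cl_mult ::
  "real \<Rightarrow> 'a::real_algebra_1 ^ (3 set) \<Rightarrow> 'a ^ (3 set) \<Rightarrow> 'a ^ (3 set)" where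
  "cl_mult \<epsilon> X Y =
    (\<chi> U. \<Sum>(S, T) | sym_diff S T = U. cl_sign \<epsilon> S T *\<^sub>R (X $ S * Y $ T))"

abbreviation cl_mult_syntax ::
  "'a::real_algebra_1 ^ (3 set) \<Rightarrow> real \<Rightarrow> 'a ^ (3 set) \<Rightarrow> 'a ^ (3 set)"
  (\<open>(_ \<star>\<^bsub>_\<^esub> _)\<close> [70, 0, 71] 70) where
  "X \<star>\<^bsub>\<epsilon>\<^esub> Y \<equiv> cl_mult \<epsilon> X Y"

definition cl_comm ::
  "real \<Rightarrow> 'a::real_algebra_1 ^ (3 set) \<Rightarrow> 'a ^ (3 set) \<Rightarrow> 'a ^ (3 set)" where
  "cl_comm \<epsilon> X Y = X \<star>\<^bsub>\<epsilon>\<^esub> Y - Y \<star>\<^bsub>\<epsilon>\<^esub> X"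

text \<open>The embeddings \<open>a \<mapsto> a \<otimes> 1\<close> and \<open>e\<^sub>j \<mapsto> 1 \<otimes> e\<^sub>j\<close>.\<close>

definition cl_of :: "'a::real_algebra_1 \<Rightarrow> 'a ^ (3 set)" where
  "cl_of a = (\<chi> S. if S = {} then a else 0)"

definition cl_gen :: "3 \<Rightarrow> 'a::real_algebra_1 ^ (3 set)" where
  "cl_gen j = (\<chi> S. if S = {j} then 1 else 0)"

lemma cl_mult_nth:
  "(X \<star>\<^bsub>\<epsilon>\<^esub> Y) $ U = (\<Sum>S\<in>UNIV. cl_sign \<epsilon> S (sym_diff S U) *\<^sub>R (X $ S * Y $ sym_diff S U))"
proof -
  have "{(S, T). sym_diff S T = U} = (\<lambda>S. (S, sym_diff S U)) ` UNIV"
    by (auto simp: set_eq_iff image_iff)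
  moreover have "inj (\<lambda>S. (S, sym_diff S U))"
    by (auto intro: injI)
  ultimately show ?thesis
    by (simp add: cl_mult_def sum.reindex case_prod_unfold)
qed

lemma cl_sign_sym_diff_left:
  "(-1::real) ^ card {(s, t). s \<in> sym_diff A B \<and> t \<in> T \<and> t < s} =
   (-1) ^ card {(s, t). s \<in> A \<and> t \<in> T \<and> t < s} * (-1) ^ card {(s, t). s \<in> B \<and> t \<in> T \<and> t < s}"
  for A B T :: "3 set"
proof -
  let ?f = "\<lambda>A. {(s, t). s \<in> A \<and> t \<in> T \<and> t < s}"
  have "card (?f A) = card (?f (A - B)) + card (?f (A \<inter> B))" for A B
    by (subst card_Un_disjoint[symmetric]) (auto intro!: arg_cong[of _ _ card])
  from this[of A B] this[of B A]
  have "card (?f A) + card (?f B) = card (?f (A - B)) + card (?f (B - A)) + 2 * card (?f (A \<inter> B))"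
    by (simp add: Int_commute)
  moreover have "card (?f (sym_diff A B)) = card (?f (A - B)) + card (?f (B - A))"
    by (subst card_Un_disjoint[symmetric]) (auto intro!: arg_cong[of _ _ card])
  ultimately have "card (?f A) + card (?f B) = card (?f (sym_diff A B)) + 2 * card (?f (A \<inter> B))"
    by presburger
  then have "(-1::real) ^ card (?f A) * (-1) ^ card (?f B) =
      (-1) ^ card (?f (sym_diff A B)) * ((-1) ^ 2) ^ card (?f (A \<inter> B))"
    by (simp only: power_add[symmetric] power_mult[symmetric])
  then show ?thesis
    by simp
qed

lemma cl_sign_sym_diff_right:
  "(-1::real) ^ card {(s, t). s \<in> T \<and> t \<in> sym_diff A B \<and> t < s} =
   (-1) ^ card {(s, t). s \<in> T \<and> t \<in> A \<and> t < s} * (-1) ^ card {(s, t). s \<in> T \<and> t \<in> B \<and> t < s}"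
  for A B T :: "3 set"
proof -
  let ?f = "\<lambda>A. {(s, t). s \<in> T \<and> t \<in> A \<and> t < s}"
  have "card (?f A) = card (?f (A - B)) + card (?f (A \<inter> B))" for A B
    by (subst card_Un_disjoint[symmetric]) (auto intro!: arg_cong[of _ _ card])
  from this[of A B] this[of B A]
  have "card (?f A) + card (?f B) = card (?f (A - B)) + card (?f (B - A)) + 2 * card (?f (A \<inter> B))"
    by (simp add: Int_commute)
  moreover have "card (?f (sym_diff A B)) = card (?f (A - B)) + card (?f (B - A))"
    by (subst card_Un_disjoint[symmetric]) (auto intro!: arg_cong[of _ _ card])
  ultimately have "card (?f A) + card (?f B) = card (?f (sym_diff A B)) + 2 * card (?f (A \<inter> B))"
    by presburger
  then have "(-1::real) ^ card (?f A) * (-1) ^ card (?f B) =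
      (-1) ^ card (?f (sym_diff A B)) * ((-1) ^ 2) ^ card (?f (A \<inter> B))"
    by (simp only: power_add[symmetric] power_mult[symmetric])
  then show ?thesis
    by simp
qed

lemma cl_sign_cocycle:
  "cl_sign \<epsilon> (sym_diff A B) C * cl_sign \<epsilon> A B = cl_sign \<epsilon> A (sym_diff B C) * cl_sign \<epsilon> B C"
proof -
  have split: "card X = card (X - Y) + card (X \<inter> Y)" for X Y :: "3 set"
    by (subst card_Un_disjoint[symmetric]) (auto intro!: arg_cong[of _ _ card])
  have "sym_diff A B \<inter> C - A = B \<inter> C - A" "sym_diff A B \<inter> C \<inter> A = A \<inter> C - B"
    "A \<inter> sym_diff B C - B = A \<inter> C - B" "A \<inter> sym_diff B C \<inter> B = A \<inter> B - C"
    "A \<inter> B \<inter> C = B \<inter> C \<inter> A"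
    by auto
  then have "card (sym_diff A B \<inter> C) + card (A \<inter> B) = card (A \<inter> sym_diff B C) + card (B \<inter> C)"
    using split[of "sym_diff A B \<inter> C" A] split[of "A \<inter> B" C]
      split[of "A \<inter> sym_diff B C" B] split[of "B \<inter> C" A] by presburger
  then have "\<epsilon> ^ card (sym_diff A B \<inter> C) * \<epsilon> ^ card (A \<inter> B) =
      \<epsilon> ^ card (A \<inter> sym_diff B C) * \<epsilon> ^ card (B \<inter> C)"
    by (simp only: power_add[symmetric])
  then show ?thesis
    unfolding cl_sign_def cl_sign_sym_diff_left cl_sign_sym_diff_right
    by (simp add: mult_ac)
qed

lemma cl_mult_assoc: "(X \<star>\<^bsub>\<epsilon>\<^esub> Y) \<star>\<^bsub>\<epsilon>\<^esub> Z = X \<star>\<^bsub>\<epsilon>\<^esub> (Y \<star>\<^bsub>\<epsilon>\<^esub> Z)"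
proof -
  have sd: "sym_diff S (sym_diff S T) = T" for S T :: "3 set"
    by auto
  have sa: "sym_diff (sym_diff A B) C = sym_diff A (sym_diff B C)" for A B C :: "3 set"
    by auto
  have bij: "bij_betw (sym_diff A) UNIV UNIV" for A :: "3 set"
    by (rule bij_betwI[of _ _ _ "sym_diff A"]) (auto simp only: sd)
  have "((X \<star>\<^bsub>\<epsilon>\<^esub> Y) \<star>\<^bsub>\<epsilon>\<^esub> Z) $ U = (X \<star>\<^bsub>\<epsilon>\<^esub> (Y \<star>\<^bsub>\<epsilon>\<^esub> Z)) $ U" for U
  proof -
    have "((X \<star>\<^bsub>\<epsilon>\<^esub> Y) \<star>\<^bsub>\<epsilon>\<^esub> Z) $ U =
      (\<Sum>S\<in>UNIV. \<Sum>A\<in>UNIV. (cl_sign \<epsilon> S (sym_diff S U) * cl_sign \<epsilon> A (sym_diff A S)) *\<^sub>R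
         (X $ A * Y $ sym_diff A S * Z $ sym_diff S U))"
      unfolding cl_mult_nth by (simp only: sum_distrib_right scaleR_sum_right mult_scaleR_left scaleR_scaleR)
    also have "\<dots> = (\<Sum>A\<in>UNIV. \<Sum>S\<in>UNIV. (cl_sign \<epsilon> S (sym_diff S U) * cl_sign \<epsilon> A (sym_diff A S)) *\<^sub>R
         (X $ A * Y $ sym_diff A S * Z $ sym_diff S U))"
      by (rule sum.swap)
    also have "\<dots> = (\<Sum>A\<in>UNIV. \<Sum>B\<in>UNIV.
         (cl_sign \<epsilon> (sym_diff A B) (sym_diff (sym_diff A B) U) * cl_sign \<epsilon> A (sym_diff A (sym_diff A B))) *\<^sub>R
         (X $ A * Y $ sym_diff A (sym_diff A B) * Z $ sym_diff (sym_diff A B) U))"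
      by (intro sum.cong refl sum.reindex_bij_betw[OF bij, symmetric])
    also have "\<dots> = (\<Sum>A\<in>UNIV. \<Sum>B\<in>UNIV.
         (cl_sign \<epsilon> A (sym_diff A U) * cl_sign \<epsilon> B (sym_diff B (sym_diff A U))) *\<^sub>R
         (X $ A * (Y $ B * Z $ sym_diff B (sym_diff A U))))"
    proof (intro sum.cong refl)
      fix A B :: "3 set"
      have c: "sym_diff (sym_diff A B) U = sym_diff B (sym_diff A U)"
        by auto
      have "cl_sign \<epsilon> (sym_diff A B) (sym_diff B (sym_diff A U)) * cl_sign \<epsilon> A B =
          cl_sign \<epsilon> A (sym_diff A U) * cl_sign \<epsilon> B (sym_diff B (sym_diff A U))"
        using cl_sign_cocycle[of \<epsilon> A B "sym_diff B (sym_diff A U)"] by (simp only: sd)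
      then show "(cl_sign \<epsilon> (sym_diff A B) (sym_diff (sym_diff A B) U) * cl_sign \<epsilon> A (sym_diff A (sym_diff A B))) *\<^sub>R
         (X $ A * Y $ sym_diff A (sym_diff A B) * Z $ sym_diff (sym_diff A B) U) =
         (cl_sign \<epsilon> A (sym_diff A U) * cl_sign \<epsilon> B (sym_diff B (sym_diff A U))) *\<^sub>R
         (X $ A * (Y $ B * Z $ sym_diff B (sym_diff A U)))"
        by (simp only: sd c mult.assoc)
    qed
    also have "\<dots> = (X \<star>\<^bsub>\<epsilon>\<^esub> (Y \<star>\<^bsub>\<epsilon>\<^esub> Z)) $ U"
      unfolding cl_mult_nth by (simp only: sum_distrib_left scaleR_sum_right mult_scaleR_right scaleR_scaleR)
    finally show ?thesis .
  qed
  then show ?thesis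
    by (simp add: vec_eq_iff)
qed

lemma cl_mult_of_left: "cl_of a \<star>\<^bsub>\<epsilon>\<^esub> X = (\<chi> S. a * X $ S)"
proof -
  have "(cl_of a \<star>\<^bsub>\<epsilon>\<^esub> X) $ U = (\<Sum>S::3 set\<in>UNIV. if S = {} then a * X $ U else 0)" for U
    unfolding cl_mult_nth by (intro sum.cong) (auto simp: cl_of_def cl_sign_def)
  then show ?thesis
    by (simp add: vec_eq_iff)
qed

lemma cl_mult_of_right: "X \<star>\<^bsub>\<epsilon>\<^esub> cl_of a = (\<chi> S. X $ S * a)"
proof -
  have "(X \<star>\<^bsub>\<epsilon>\<^esub> cl_of a) $ U = (\<Sum>S\<in>UNIV. if S = U then X $ U * a else 0)" for U
    unfolding cl_mult_nth by (intro sum.cong) (auto simp: cl_of_def cl_sign_def)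
  then show ?thesis
    by (simp add: vec_eq_iff)
qed

lemma cl_of_mult: "cl_of (a * b) = cl_of a \<star>\<^bsub>\<epsilon>\<^esub> cl_of b"
  by (simp add: cl_mult_of_left) (simp add: cl_of_def vec_eq_iff)

lemma cl_of_gen_commute: "cl_of a \<star>\<^bsub>\<epsilon>\<^esub> cl_gen j = cl_gen j \<star>\<^bsub>\<epsilon>\<^esub> cl_of a"
  by (simp add: cl_mult_of_left cl_mult_of_right) (simp add: cl_gen_def vec_eq_iff fun_eq_iff)

lemma cl_gen_mult:
  "(cl_gen j \<star>\<^bsub>\<epsilon>\<^esub> cl_gen k :: 'a::real_algebra_1 ^ (3 set)) =
    (\<chi> S. if S = sym_diff {j} {k} then of_real (cl_sign \<epsilon> {j} {k}) else 0)"
proof -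
  have "(cl_gen j \<star>\<^bsub>\<epsilon>\<^esub> cl_gen k :: 'a ^ (3 set)) $ U =
      (\<Sum>S\<in>UNIV. if S = {j} then if U = sym_diff {j} {k} then of_real (cl_sign \<epsilon> {j} {k}) else 0 else 0)" for U
    unfolding cl_mult_nth
    by (rule sum.cong) (auto simp: cl_gen_def of_real_def)
  then show ?thesis
    by (simp only: vec_eq_iff sum.delta finite UNIV_I if_True vec_lambda_beta refl simp_thms)
qed

lemma cl_gen_anticommute:
  "cl_gen j \<star>\<^bsub>\<epsilon>\<^esub> cl_gen k + cl_gen k \<star>\<^bsub>\<epsilon>\<^esub> cl_gen j = (if j = k then cl_of (of_real (2 * \<epsilon>)) else 0)"
proof -
  have inv: "{(s, t). s = j \<and> t = k \<and> t < s} = (if k < j then {(j, k)} else {})" for j k :: 3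
    by auto
  show ?thesis
    by (auto simp: cl_gen_mult cl_of_def vec_eq_iff cl_sign_def inv mult_2[symmetric])
qed


section \<open>The symmetry algebra\<close>

definition dunkl_dirac :: "nat \<Rightarrow> (real^3 \<Rightarrow> complex) \<Rightarrow> real \<Rightarrow> lop ^ (3 set)" where
  "dunkl_dirac m \<kappa> \<epsilon> = (\<Sum>j\<in>UNIV. cl_of (dunkl m \<kappa> j) \<star>\<^bsub>\<epsilon>\<^esub> cl_gen j)"

definition sym1 :: "nat \<Rightarrow> (real^3 \<Rightarrow> complex) \<Rightarrow> real \<Rightarrow> 3 \<Rightarrow> lop ^ (3 set)" where
  "sym1 m \<kappa> \<epsilon> j =
    (\<epsilon> / 2) *\<^sub>R (cl_comm \<epsilon> (dunkl_dirac m \<kappa> \<epsilon>) (cl_of (mult_var j)) - cl_gen j)"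

definition dunkl_ang :: "nat \<Rightarrow> (real^3 \<Rightarrow> complex) \<Rightarrow> 3 \<Rightarrow> 3 \<Rightarrow> lop" where
  "dunkl_ang m \<kappa> i j = mult_var i * dunkl m \<kappa> j - mult_var j * dunkl m \<kappa> i"

definition sym2 :: "nat \<Rightarrow> (real^3 \<Rightarrow> complex) \<Rightarrow> real \<Rightarrow> 3 \<Rightarrow> 3 \<Rightarrow> lop ^ (3 set)" where
  "sym2 m \<kappa> \<epsilon> i j =
    cl_of (dunkl_ang m \<kappa> i j) + (\<epsilon> / 2) *\<^sub>R (cl_gen i \<star>\<^bsub>\<epsilon>\<^esub> cl_gen j)
    + sym1 m \<kappa> \<epsilon> i \<star>\<^bsub>\<epsilon>\<^esub> cl_gen j - sym1 m \<kappa> \<epsilon> j \<star>\<^bsub>\<epsilon>\<^esub> cl_gen i"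

definition sym3 :: "nat \<Rightarrow> (real^3 \<Rightarrow> complex) \<Rightarrow> real \<Rightarrow> lop ^ (3 set)" where
  "sym3 m \<kappa> \<epsilon> =
    - ((\<epsilon> / 2) *\<^sub>R (cl_gen 1 \<star>\<^bsub>\<epsilon>\<^esub> cl_gen 2 \<star>\<^bsub>\<epsilon>\<^esub> cl_gen 3))
    - sym1 m \<kappa> \<epsilon> 1 \<star>\<^bsub>\<epsilon>\<^esub> cl_gen 2 \<star>\<^bsub>\<epsilon>\<^esub> cl_gen 3
    - sym1 m \<kappa> \<epsilon> 2 \<star>\<^bsub>\<epsilon>\<^esub> cl_gen 3 \<star>\<^bsub>\<epsilon>\<^esub> cl_gen 1
    - sym1 m \<kappa> \<epsilon> 3 \<star>\<^bsub>\<epsilon>\<^esub> cl_gen 1 \<star>\<^bsub>\<epsilon>\<^esub> cl_gen 2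
    + sym2 m \<kappa> \<epsilon> 1 2 \<star>\<^bsub>\<epsilon>\<^esub> cl_gen 3
    + sym2 m \<kappa> \<epsilon> 3 1 \<star>\<^bsub>\<epsilon>\<^esub> cl_gen 2
    + sym2 m \<kappa> \<epsilon> 2 3 \<star>\<^bsub>\<epsilon>\<^esub> cl_gen 1"

text \<open>
  For \<open>\<alpha> = (sin \<theta>, - cos \<theta>, 0)\<close> the reflection is given by
  \<open>x\<^sub>1 \<mapsto> cos 2\<theta> x\<^sub>1 + sin 2\<theta> x\<^sub>2\<close>, \<open>x\<^sub>2 \<mapsto> sin 2\<theta> x\<^sub>1 - cos 2\<theta> x\<^sub>2\<close>, \<open>x\<^sub>3 \<mapsto> x\<^sub>3\<close>, so conjugation
  by \<open>sigma_tilde \<epsilon> \<alpha>\<close> sends \<open>O\<^sub>3\<^sub>1\<close> to \<open>cos 2\<theta> O\<^sub>3\<^sub>1 - sin 2\<theta> O\<^sub>2\<^sub>3\<close> and \<open>O\<^sub>2\<^sub>3\<close> to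
  \<open>- sin 2\<theta> O\<^sub>3\<^sub>1 - cos 2\<theta> O\<^sub>2\<^sub>3\<close>. The source prints \<open>cos 2\<theta> O\<^sub>3\<^sub>1 + sin 2\<theta> O\<^sub>2\<^sub>3\<close> and
  \<open>- cos 2\<theta> O\<^sub>3\<^sub>1 + sin 2\<theta> O\<^sub>2\<^sub>3\<close>, which is not an involution although
  \<open>(sigma_tilde \<epsilon> \<alpha>)\<^sup>2 = \<epsilon>\<close>; the corrected coefficients are the ones used.
\<close>

definition sigma_tilde :: "real \<Rightarrow> real^3 \<Rightarrow> lop ^ (3 set)" where
  "sigma_tilde \<epsilon> \<alpha> =
    cl_of (reflection_op \<alpha>) \<star>\<^bsub>\<epsilon>\<^esub> (\<Sum>j\<in>UNIV. (\<alpha> \<bullet> axis j 1) *\<^sub>R cl_gen j)"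

inductive_set W_tilde :: "nat \<Rightarrow> real \<Rightarrow> (lop ^ (3 set)) set" for m \<epsilon> where
  gen: "\<alpha> \<in> dih_roots m \<Longrightarrow> sigma_tilde \<epsilon> \<alpha> \<in> W_tilde m \<epsilon>"
| one: "cl_of 1 \<in> W_tilde m \<epsilon>"
| mult: "v \<in> W_tilde m \<epsilon> \<Longrightarrow> w \<in> W_tilde m \<epsilon> \<Longrightarrow> v \<star>\<^bsub>\<epsilon>\<^esub> w \<in> W_tilde m \<epsilon>"
| inverse: "w \<in> W_tilde m \<epsilon> \<Longrightarrow> v \<star>\<^bsub>\<epsilon>\<^esub> w = cl_of 1 \<Longrightarrow> w \<star>\<^bsub>\<epsilon>\<^esub> v = cl_of 1 \<Longrightarrow> v \<in> W_tilde m \<epsilon>"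

definition cl_scaleC :: "complex \<Rightarrow> lop ^ (3 set) \<Rightarrow> lop ^ (3 set)" where
  "cl_scaleC c X = (\<chi> S. scaleC_lop c (X $ S))"

definition group_algebra :: "nat \<Rightarrow> real \<Rightarrow> (lop ^ (3 set)) set" where
  "group_algebra m \<epsilon> =
    {\<Sum>w\<in>F. cl_scaleC (c w) w | F c. finite F \<and> F \<subseteq> W_tilde m \<epsilon>}"

inductive_set generated_algebra ::
  "real \<Rightarrow> (lop ^ (3 set)) set \<Rightarrow> (lop ^ (3 set)) set" for \<epsilon> G where
  gen: "X \<in> G \<Longrightarrow> X \<in> generated_algebra \<epsilon> G"
| one: "cl_of 1 \<in> generated_algebra \<epsilon> G"
| add: "X \<in> generated_algebra \<epsilon> G \<Longrightarrow> Y \<in> generated_algebra \<epsilon> G \<Longrightarrow>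
    X + Y \<in> generated_algebra \<epsilon> G"
| scale: "X \<in> generated_algebra \<epsilon> G \<Longrightarrow> cl_scaleC c X \<in> generated_algebra \<epsilon> G"
| mult: "X \<in> generated_algebra \<epsilon> G \<Longrightarrow> Y \<in> generated_algebra \<epsilon> G \<Longrightarrow>
    X \<star>\<^bsub>\<epsilon>\<^esub> Y \<in> generated_algebra \<epsilon> G"

text \<open>
  The ambient algebra used here is (all linear operators on polynomials) \<open>\<otimes>\<close> Clifford
  algebra. It contains the tensor product of the Clifford algebra with the algebra generated by
  the Dunkl operators, the variables and the reflection group, so a subalgebra generated
  by elements of the latter is the same in both.
\<close>

definition sym_algebra :: "nat \<Rightarrow> (real^3 \<Rightarrow> complex) \<Rightarrow> real \<Rightarrow> (lop ^ (3 set)) set" where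
  "sym_algebra m \<kappa> \<epsilon> = generated_algebra \<epsilon>
    ({sym2 m \<kappa> \<epsilon> 1 2, sym2 m \<kappa> \<epsilon> 3 1, sym2 m \<kappa> \<epsilon> 2 3, sym3 m \<kappa> \<epsilon>}
     \<union> group_algebra m \<epsilon>)"

end

theory Submission
  imports Defs
begin

text \<open>
  Write \<open>D\<close> for the Dunkl--Dirac operator, \<open>x = x\<^sub>1e\<^sub>1 + x\<^sub>2e\<^sub>2 + x\<^sub>3e\<^sub>3\<close> and \<open>\<omega> = e\<^sub>1e\<^sub>2e\<^sub>3\<close>, which is
  central with \<open>\<omega>\<^sup>2 = -\<epsilon>\<close>. The proof reduces every claim to commutation with \<open>D\<close> and \<open>x\<close>.

  The analytic input consists of the commutators \<open>[D\<^sub>i, x\<^sub>j]\<close>, the equivariance of the Dunkl operators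
  and their commutativity (\<open>reflection_op_dunkl_vec\<close>, \<open>dunkl_vec_commute\<close>). The last two hold because
  an operator that kills \<open>1\<close> and intertwines the coordinates with some operators vanishes.

  By equivariance, the elements covering the reflections anticommute with \<open>D\<close> and \<open>x\<close>, and so do the
  one-index symmetries, being combinations of them. A short computation then shows that the two-index
  symmetries commute with \<open>D\<close> and \<open>x\<close> (\<open>O2_Xvec\<close>, \<open>O2_Dirac\<close>). Since \<open>2 O\<^sub>1\<^sub>2\<^sub>3 = ([D, x] - \<epsilon>) \<omega>\<close>
  (\<open>O3_eq\<close>), all generators of the symmetry algebra commute with \<open>O\<^sub>1\<^sub>2\<^sub>3\<close>, which is (i).

  For (ii) and (iii) the key is that, for cyclic \<open>i, j, k\<close>, one has \<open>4 O\<^sub>j\<^sub>k = \<Psi>(e\<^sub>i)\<close> with the linear map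
  \<open>\<Psi>(E) = 2\<epsilon> {O\<^sub>1\<^sub>2\<^sub>3, E} - \<epsilon> [D, {x, E}] \<omega>\<close> (\<open>O2_eq_O3\<close>, \<open>Psi_gen\<close>). Conjugation by a covering element
  passes through \<open>\<Psi>\<close> and is a signed reflection on the \<open>e\<^sub>i\<close>, which is (iii). The derivation
  \<open>[O\<^sub>i\<^sub>j, -]\<close> passes through \<open>\<Psi>\<close> as well, so that \<open>4 [O\<^sub>i\<^sub>j, O\<^sub>k\<^sub>i] = \<Psi>([O\<^sub>i\<^sub>j, e\<^sub>j])\<close>; the argument is
  \<open>e\<^sub>i + 2\<epsilon> O\<^sub>i + \<epsilon> \<omega> [e\<^sub>k, O\<^sub>j]\<close>, and \<open>\<Psi>\<close> of its three terms is computed separately, giving (ii).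
\<close>

section \<open>Linear operators on polynomials\<close>

lemma app_mult_var [simp]: "app (mult_var k) f = pvar k * f"
  by (simp add: mult_var.rep_eq)

lemma app_deriv_op [simp]: "app (deriv_op k) f = partial_deriv k f"
  by (simp add: deriv_op.rep_eq)

lemma app_reflection_op [simp]: "app (reflection_op \<alpha>) f = pcomp_reflection \<alpha> f"
  by (simp add: reflection_op.rep_eq)

lemma app_zero_right [simp]: "app T 0 = 0"
  using app_linear(1)[of T 0 0] by simp

text \<open>
  The polynomials multiplication by which preserves the kernel form a subalgebra. As it contains the
  coordinates, it contains every polynomial \<open>p\<close>, and then \<open>p = p \<cdot> 1\<close> lies in the kernel.
\<close>

lemma lop_eq_zero_if_kernel_closed:
  assumes one: "app T 1 = 0"
    and step: "\<And>k f. app T f = 0 \<Longrightarrow> app T (pvar k * f) = 0"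
  shows "T = 0"
proof -
  define N where "N = {p. \<forall>g. app T g = 0 \<longrightarrow> app T (p * g) = 0}"
  have N_var: "pvar k \<in> N" for k
    using step by (simp add: N_def)
  have N_const: "pconst c \<in> N" for c
    by (simp add: N_def)
  have N_add: "p + q \<in> N" if "p \<in> N" "q \<in> N" for p q
    using that by (simp add: N_def distrib_right)
  have N_mult: "p * q \<in> N" if "p \<in> N" "q \<in> N" for p q
    using that by (simp add: N_def mult.assoc)
  have N_sum: "(\<Sum>i\<in>I. p i) \<in> N" if "\<And>i. p i \<in> N" for I :: "3 set" and p
    using that by (induction I rule: infinite_finite_induct)
      (auto intro: N_add simp: N_def distrib_right)
  have real: "\<exists>p\<in>N. \<forall>x. peval p x = of_real (f x)" if "real_polynomial_function f" for f
    using that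
  proof induction
    case (linear f)
    then have lf: "linear f"
      by (rule bounded_linear.linear)
    have f: "(\<Sum>k\<in>UNIV. f (axis k 1) * x $ k) = f x" for x
    proof -
      have "f x = f (\<Sum>k\<in>UNIV. x $ k *\<^sub>R axis k 1)"
        using basis_expansion[of x] by (simp add: scalar_mult_eq_scaleR)
      then show ?thesis
        by (simp add: linear_sum[OF lf] linear_scale[OF lf] mult.commute)
    qed
    show ?case
      by (intro bexI[of _ "\<Sum>k\<in>UNIV. pconst (of_real (f (axis k 1))) * pvar k"] N_sum N_mult
          N_const N_var) (simp flip: of_real_mult of_real_sum add: f)
  next
    case (const c)
    then show ?case
      by (intro bexI[of _ "pconst (of_real c)"] N_const) simp
  next
    case (add f g)
    then show ?case
      by (metis N_add peval_simps(3) of_real_add)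
  next
    case (mult f g)
    then show ?case
      by (metis N_mult peval_simps(6) of_real_mult)
  qed
  show "T = 0"
  proof (rule lop_eqI)
    fix f
    have "polynomial_function (peval f)"
      using peval by auto
    then obtain p q where p: "p \<in> N" "\<And>x. peval p x = of_real (Re (peval f x))"
      and q: "q \<in> N" "\<And>x. peval q x = of_real (Im (peval f x))"
      unfolding polynomial_function_complex_iff using real by meson
    have f: "f = p + pconst \<i> * q"
      by (rule poly3_eqI) (simp add: p q complex_eq_iff)
    have "f \<in> N"
      unfolding f by (intro N_add N_mult N_const p(1) q(1))
    with one show "app T f = app 0 f"
      by (auto simp: N_def)
  qed
qed

text \<open>
  This is applied to operators commuting with the coordinates and to operators intertwining them
  with their images under a reflection.
\<close>

lemma lop_eq_zero_if_intertwines: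
  assumes "app T 1 = 0" and "\<And>k. T * mult_var k = S k * T"
  shows "T = 0"
proof (rule lop_eq_zero_if_kernel_closed)
  fix k f
  assume "app T f = 0"
  then have "app (T * mult_var k) f = 0"
    unfolding assms(2) by simp
  then show "app T (pvar k * f) = 0"
    by simp
qed (rule assms(1))

lemma pconst_simps [simp]:
  "pconst 0 = 0" "pconst 1 = 1" "pconst (a + b) = pconst a + pconst b"
  "pconst (a * b) = pconst a * pconst b"
  by (rule poly3_eqI; simp)+

lemma scaleC_lop_mult [simp]:
  "scaleC_lop c S * T = scaleC_lop c (S * T)" "S * scaleC_lop c T = scaleC_lop c (S * T)"
  by (rule lop_eqI; simp)+

lemma scaleC_lop_add:
  "scaleC_lop c (S + T) = scaleC_lop c S + scaleC_lop c T"
  "scaleC_lop (c + d) S = scaleC_lop c S + scaleC_lop d S"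
  by (rule lop_eqI; simp add: algebra_simps)+

lemma scaleC_lop_scaleR:
  "r *\<^sub>R scaleC_lop c S = scaleC_lop (of_real r * c) S"
  "scaleC_lop c (r *\<^sub>R S) = scaleC_lop (of_real r * c) S"
  by (rule lop_eqI; simp add: mult_ac)+

lemma linear_scaleC_lop: "linear (scaleC_lop c)"
  by (rule linearI) (simp_all add: scaleC_lop_add scaleC_lop_scaleR)

text \<open>
  Multiplication operators and Dunkl operators indexed by vectors, so that reflections act on the
  index.
\<close>

definition mult_vec :: "real^3 \<Rightarrow> lop" where
  "mult_vec v = (\<Sum>k\<in>UNIV. v $ k *\<^sub>R mult_var k)"

definition dunkl_vec :: "nat \<Rightarrow> (real^3 \<Rightarrow> complex) \<Rightarrow> real^3 \<Rightarrow> lop" where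
  "dunkl_vec m \<kappa> v = (\<Sum>k\<in>UNIV. v $ k *\<^sub>R dunkl m \<kappa> k)"

lemma linear_mult_vec: "linear mult_vec"
  by (rule linearI) (simp_all add: mult_vec_def algebra_simps sum.distrib scaleR_sum_right)

lemma linear_dunkl_vec: "linear (dunkl_vec m \<kappa>)"
  by (rule linearI) (simp_all add: dunkl_vec_def algebra_simps sum.distrib scaleR_sum_right)

lemma sum_axis_scaleR: "(\<Sum>k\<in>UNIV. axis j (1::real) $ k *\<^sub>R g k) = (g j :: 'a::real_vector)"
proof -
  have "(\<Sum>k\<in>UNIV. axis j (1::real) $ k *\<^sub>R g k) = (\<Sum>k\<in>UNIV. if k = j then g k else 0)"
    by (rule sum.cong) (auto simp: axis_def)
  then show ?thesis by simp
qed

lemma mult_vec_axis: "mult_vec (axis j 1) = mult_var j"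
  and dunkl_vec_axis: "dunkl_vec m \<kappa> (axis j 1) = dunkl m \<kappa> j"
  unfolding mult_vec_def dunkl_vec_def by (rule sum_axis_scaleR)+

lemma peval_mult_vec: "peval (app (mult_vec v) f) x = of_real (v \<bullet> x) * peval f x"
  by (simp add: mult_vec_def inner_vec_def sum_distrib_left sum_distrib_right mult_ac)

lemma mult_vec_commute: "mult_vec v * mult_vec w = mult_vec w * mult_vec v"
  by (rule lop_eqI, rule poly3_eqI) (simp add: peval_mult_vec mult_ac)

lemma reflection_minus: "reflection \<alpha> (- v) = - reflection \<alpha> v"
  and reflection_scaleR: "reflection \<alpha> (r *\<^sub>R v) = r *\<^sub>R reflection \<alpha> v"
  using linear_reflection linear_neg linear_scale by metis+

lemma reflection_uminus_root: "reflection (- \<alpha>) = reflection \<alpha>"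
  by (simp add: reflection_def fun_eq_iff)

lemma reflection_self: "reflection \<alpha> \<alpha> = - \<alpha>"
  by (cases "\<alpha> = 0") (simp_all add: reflection_def scaleR_2)

lemma reflection_reflection [simp]: "reflection \<alpha> (reflection \<alpha> x) = x"
  by (cases "\<alpha> = 0") (simp_all add: reflection_def algebra_simps)

lemma inner_reflection: "reflection \<alpha> x \<bullet> y = x \<bullet> reflection \<alpha> y"
  by (simp add: reflection_def algebra_simps inner_commute)

lemma inner_reflection_reflection [simp]: "reflection \<alpha> x \<bullet> reflection \<alpha> y = x \<bullet> y"
  by (simp add: inner_reflection)

lemma reflection_unit: "\<alpha> \<bullet> \<alpha> = 1 \<Longrightarrow> reflection \<alpha> x = x - (2 * (\<alpha> \<bullet> x)) *\<^sub>R \<alpha>"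
  by (simp add: reflection_def inner_commute)

lemma reflection_conj: "reflection (reflection \<alpha> \<beta>) x = reflection \<alpha> (reflection \<beta> (reflection \<alpha> x))"
proof -
  have "reflection (reflection \<alpha> \<beta>) x = x - (2 * (reflection \<alpha> x \<bullet> \<beta>) / (\<beta> \<bullet> \<beta>)) *\<^sub>R reflection \<alpha> \<beta>"
    unfolding reflection_def[of "reflection \<alpha> \<beta>"] by (simp add: inner_reflection)
  also have "\<dots> = reflection \<alpha> (reflection \<beta> (reflection \<alpha> x))"
    unfolding reflection_def[of \<beta>] by (simp add: linear_diff[OF linear_reflection] reflection_scaleR)
  finally show ?thesis .
qed

lemma reflection_op_one [simp]: "app (reflection_op \<alpha>) 1 = 1"
  by (rule poly3_eqI) simp

lemma reflection_op_mult_vec: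
  "reflection_op \<alpha> * mult_vec v = mult_vec (reflection \<alpha> v) * reflection_op \<alpha>"
  by (rule lop_eqI, rule poly3_eqI) (simp add: peval_mult_vec inner_reflection)

lemma reflection_op_conj:
  "reflection_op \<alpha> * reflection_op \<beta> = reflection_op (reflection \<alpha> \<beta>) * reflection_op \<alpha>"
  by (rule lop_eqI, rule poly3_eqI) (simp add: reflection_conj)

lemma reflection_op_uminus: "reflection_op (- \<alpha>) = reflection_op \<alpha>"
  by (rule lop_eqI, rule poly3_eqI) (simp add: reflection_uminus_root)

section \<open>The dihedral root system\<close>

lemma inner_vec3: "(v :: real^3) \<bullet> w = v $ 1 * w $ 1 + v $ 2 * w $ 2 + v $ 3 * w $ 3"
  by (simp add: inner_vec_def sum_3)

lemma vec3_eq_iff: "(v :: real^3) = w \<longleftrightarrow> v $ 1 = w $ 1 \<and> v $ 2 = w $ 2 \<and> v $ 3 = w $ 3"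
  by (simp add: vec_eq_iff forall_3)

lemma dih_roots_unit: "\<alpha> \<in> dih_roots m \<Longrightarrow> \<alpha> \<bullet> \<alpha> = 1"
  by (auto simp: dih_roots_def dih_root0_def dih_root_def inner_vec3 simp flip: power2_eq_square)

text \<open>
  The roots are indexed by \<open>1, \<dots>, 2m\<close>, but a reflection produces an arbitrary integral
  multiple of \<open>\<pi>/m\<close> as angle; periodicity brings it back into the range.
\<close>

lemma dih_root_int_mem:
  assumes "m \<ge> 1"
  shows "vector [sin (of_int n * pi / real m), - cos (of_int n * pi / real m), 0]
    \<in> dih_root m ` {1..2 * m}"
proof -
  define r q where "r = (n - 1) mod (2 * int m)" and "q = (n - 1) div (2 * int m)"
  have r: "0 \<le> r" "r < 2 * int m"
    using assms by (auto simp: r_def)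
  have n: "n = (r + 1) + q * (2 * int m)"
    using div_mult_mod_eq[of "n - 1" "2 * int m"] by (simp add: r_def q_def algebra_simps)
  define j where "j = nat (r + 1)"
  have j: "j \<in> {1..2 * m}" "real j = of_int r + 1"
    using r by (auto simp: j_def)
  have "of_int n * pi / real m = real j * pi / real m + 2 * pi * of_int q"
    using assms by (simp add: n j(2) field_simps)
  moreover have "sin (2 * pi * of_int q) = 0" "cos (2 * pi * of_int q) = 1"
    by (simp_all add: sin_int_2pin cos_int_2pin)
  ultimately have "vector [sin (of_int n * pi / real m), - cos (of_int n * pi / real m), 0]
      = dih_root m j"
    by (simp only: sin_add cos_add dih_root_def) simp
  with j(1) show ?thesis by blast
qed

lemma dih_root_shift: "m \<ge> 1 \<Longrightarrow> dih_root m (j + m) = - dih_root m j"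
  by (simp add: dih_root_def add_divide_distrib distrib_right vec3_eq_iff)

text \<open>
  Mirroring the angle \<open>j\<pi>/m\<close> at the angle \<open>k\<pi>/m\<close> gives the index \<open>2k - j\<close>. The shift by \<open>m\<close>, a half
  turn, is there because the root is normal to the mirror and not contained in it.
\<close>

lemma reflection_dih_root:
  "reflection (dih_root m k) (dih_root m j) =
    vector [sin (of_int (2 * int k - int j + int m) * pi / real m),
      - cos (of_int (2 * int k - int j + int m) * pi / real m), 0]" if "m \<ge> 1"
proof -
  define a b where "a = real k * pi / real m" and "b = real j * pi / real m"
  have ang: "of_int (2 * int k - int j + int m) * pi / real m = 2 * a - b + pi"
    using that by (simp add: a_def b_def field_simps)
  have u: "dih_root m k \<bullet> dih_root m k = 1"
    by (auto simp: dih_root_def inner_vec3 simp flip: power2_eq_square)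
  have "sin b - 2 * (sin a * sin b + cos a * cos b) * sin a = - sin (2 * a - b)"
    "- cos b + 2 * (sin a * sin b + cos a * cos b) * cos a = cos (2 * a - b)"
    unfolding sin_diff cos_diff sin_double cos_double
    using sin_cos_squared_add[of a] by algebra+
  then show ?thesis
    unfolding reflection_unit[OF u] ang
    by (simp add: vec3_eq_iff inner_vec3 dih_root_def flip: a_def b_def)
qed

lemma reflection_dih_roots:
  assumes "m \<ge> 1" "\<alpha> \<in> dih_roots m" "\<beta> \<in> dih_roots m"
  shows "reflection \<alpha> \<beta> \<in> dih_roots m"
proof -
  have orth: "dih_root0 \<bullet> dih_root m j = 0" "dih_root m j \<bullet> dih_root0 = 0" for j
    by (simp_all add: dih_root0_def dih_root_def inner_vec3)
  have "reflection (dih_root m k) (dih_root m j) \<in> dih_root m ` {1..2 * m}" for j k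
    unfolding reflection_dih_root[OF assms(1)] by (rule dih_root_int_mem[OF assms(1)])
  moreover have "reflection dih_root0 (dih_root m j) = dih_root m j"
    "reflection (dih_root m j) dih_root0 = dih_root0" for j
    by (simp_all add: reflection_def orth)
  ultimately show ?thesis
    using assms(2,3)
    by (auto simp: dih_roots_def reflection_uminus_root reflection_minus reflection_self)
qed

lemma dih_roots_eq:
  assumes "m \<ge> 1"
  shows "dih_roots m = pos_roots m \<union> uminus ` pos_roots m"
proof -
  have "{1..2*m} = {1..m} \<union> (\<lambda>j. j + m) ` {1..m}"
    unfolding image_add_atLeastAtMost' by auto
  then have "dih_root m ` {1..2*m} = dih_root m ` {1..m} \<union> uminus ` dih_root m ` {1..m}"
    by (simp only: image_Un image_image dih_root_shift[OF assms])
  then show ?thesis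
    by (auto simp: dih_roots_def pos_roots_def)
qed

lemma pos_roots_disjoint: "pos_roots m \<inter> uminus ` pos_roots m = {}"
proof -
  \<comment> \<open>Positive roots are the lexicographically positive ones, the third coordinate coming first.\<close>
  define P :: "real^3 \<Rightarrow> bool" where
    "P \<beta> \<longleftrightarrow> \<beta> $ 3 > 0 \<or> \<beta> $ 3 = 0 \<and> (\<beta> $ 1 > 0 \<or> \<beta> $ 1 = 0 \<and> \<beta> $ 2 > 0)" for \<beta>
  have P: "P \<beta>" if mem: "\<beta> \<in> pos_roots m" for \<beta>
  proof (cases "\<beta> = dih_root0")
    case True
    then show ?thesis by (simp add: P_def dih_root0_def)
  next
    case False
    then obtain j where j: "\<beta> = dih_root m j" "1 \<le> j" "j \<le> m"
      using mem by (auto simp: pos_roots_def)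
    show ?thesis
    proof (cases "j = m")
      case True
      with j show ?thesis by (simp add: P_def dih_root_def)
    next
      case False
      have "0 < sin (real j * pi / real m)"
        using j False by (intro sin_gt_zero) (auto simp: field_simps)
      with j show ?thesis by (simp add: P_def dih_root_def)
    qed
  qed
  have "\<not> P (- \<beta>)" if "P \<beta>" for \<beta>
    using that by (auto simp: P_def)
  with P show ?thesis by blast
qed

lemma finite_pos_roots [simp]: "finite (pos_roots m)"
  by (simp add: pos_roots_def)

lemma pos_roots_subset: "m \<ge> 1 \<Longrightarrow> pos_roots m \<subseteq> dih_roots m"
  by (auto simp: dih_roots_eq)

text \<open>
  A reflection need not permute the positive roots, but it permutes all roots, and the sum of an
  even function over all roots is twice the sum over the positive ones.
\<close>

lemma sum_pos_roots_reflection: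
  fixes F :: "real^3 \<Rightarrow> 'a::real_vector"
  assumes "m \<ge> 1" "\<alpha> \<in> dih_roots m" and even: "\<And>\<beta>. \<beta> \<in> dih_roots m \<Longrightarrow> F (- \<beta>) = F \<beta>"
  shows "(\<Sum>\<beta>\<in>pos_roots m. F (reflection \<alpha> \<beta>)) = (\<Sum>\<beta>\<in>pos_roots m. F \<beta>)"
proof -
  have double: "(\<Sum>\<beta>\<in>dih_roots m. G \<beta>) = 2 *\<^sub>R (\<Sum>\<beta>\<in>pos_roots m. G \<beta>)"
    if "\<And>\<beta>. \<beta> \<in> dih_roots m \<Longrightarrow> G (- \<beta>) = G \<beta>" for G :: "real^3 \<Rightarrow> 'a"
  proof -
    have "(\<Sum>\<beta>\<in>uminus ` pos_roots m. G \<beta>) = (\<Sum>\<beta>\<in>pos_roots m. G (- \<beta>))"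
      by (subst sum.reindex) (auto simp: inj_on_def)
    also have "\<dots> = (\<Sum>\<beta>\<in>pos_roots m. G \<beta>)"
      using pos_roots_subset[OF assms(1)] that by (intro sum.cong) auto
    finally show ?thesis
      unfolding dih_roots_eq[OF assms(1)]
      by (subst sum.union_disjoint) (auto simp: pos_roots_disjoint scaleR_2)
  qed
  have "(\<Sum>\<beta>\<in>dih_roots m. F (reflection \<alpha> \<beta>)) = (\<Sum>\<beta>\<in>dih_roots m. F \<beta>)"
    by (rule sum.reindex_bij_witness[of _ "reflection \<alpha>" "reflection \<alpha>"])
      (use reflection_dih_roots assms in auto)
  then have "2 *\<^sub>R (\<Sum>\<beta>\<in>pos_roots m. F (reflection \<alpha> \<beta>)) = 2 *\<^sub>R (\<Sum>\<beta>\<in>pos_roots m. F \<beta>)"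
    by (subst (asm) (1 2) double)
      (use even reflection_dih_roots[OF assms(1,2)] in \<open>auto simp: reflection_minus\<close>)
  then show ?thesis by simp
qed

lemma orbit_invariant_reflection:
  assumes "orbit_invariant m \<kappa>" "\<alpha> \<in> dih_roots m" "\<beta> \<in> dih_roots m"
  shows "\<kappa> (reflection \<alpha> \<beta>) = \<kappa> \<beta>"
proof -
  have "reflection \<alpha> \<circ> id \<in> reflection_group m"
    using assms(2) by (intro reflection_group.intros)
  then show ?thesis
    using assms(1,3) unfolding orbit_invariant_def by fastforce
qed

lemma orbit_invariant_uminus:
  assumes "orbit_invariant m \<kappa>" "\<beta> \<in> dih_roots m"
  shows "\<kappa> (- \<beta>) = \<kappa> \<beta>"
  using orbit_invariant_reflection[OF assms(1,2,2)] by (simp add: reflection_self)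

section \<open>Dunkl operators\<close>

lemma partial_deriv_pvar_mult:
  "partial_deriv j (pvar k * f) = (if j = k then f else 0) + pvar k * partial_deriv j f"
proof (rule partial_deriv_eqI)
  fix x :: "real^3"
  have "((\<lambda>t. x $ k + t * (if j = k then 1 else 0)) has_real_derivative
      (if j = k then 1 else 0)) (at 0)"
    by (auto intro!: derivative_eq_intros)
  then have "((\<lambda>t. complex_of_real (x $ k + t * (if j = k then 1 else 0)))
      has_vector_derivative of_real (if j = k then 1 else 0)) (at 0)"
    by (rule has_vector_derivative_of_real)
  moreover have "(\<lambda>t. complex_of_real (x $ k + t * (if j = k then 1 else 0))) =
      (\<lambda>t. peval (pvar k) (x + t *\<^sub>R axis j 1))"
    by (auto simp: axis_def)
  ultimately have "((\<lambda>t. peval (pvar k) (x + t *\<^sub>R axis j 1)) has_vector_derivative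
      of_real (if j = k then 1 else 0)) (at 0)"
    by (simp only:)
  from has_vector_derivative_mult[OF this partial_deriv_has_vector_derivative[of f x j]]
  show "((\<lambda>t. peval (pvar k * f) (x + t *\<^sub>R axis j 1)) has_vector_derivative
      peval ((if j = k then f else 0) + pvar k * partial_deriv j f) x) (at 0)"
    by (auto simp: add.commute)
qed

lemma partial_deriv_one: "partial_deriv j 1 = 0"
  by (rule partial_deriv_eqI) simp

lemma deriv_op_mult_var:
  "deriv_op j * mult_var k = mult_var k * deriv_op j + (if j = k then 1 else 0)"
  by (rule lop_eqI) (simp add: partial_deriv_pvar_mult)

lemma app_divided_difference_op:
  "\<alpha> \<noteq> 0 \<Longrightarrow> app (divided_difference_op \<alpha>) f = divided_difference \<alpha> f"
  by (simp add: divided_difference_op.rep_eq)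

lemma divided_difference_op_mult_var:
  assumes "\<alpha> \<bullet> \<alpha> = 1"
  shows "divided_difference_op \<alpha> * mult_var k =
    mult_var k * divided_difference_op \<alpha> + (2 * \<alpha> $ k) *\<^sub>R reflection_op \<alpha>"
proof (rule lop_eqI)
  fix f
  have \<alpha>: "\<alpha> \<noteq> 0"
    using assms by auto
  have "divided_difference \<alpha> (pvar k * f) =
      pvar k * divided_difference \<alpha> f + pconst (of_real (2 * \<alpha> $ k)) * pcomp_reflection \<alpha> f"
    by (rule divided_difference_eqI[OF \<alpha>])
      (simp add: peval_divided_difference reflection_def assms field_simps)
  then show "app (divided_difference_op \<alpha> * mult_var k) f =
      app (mult_var k * divided_difference_op \<alpha> + (2 * \<alpha> $ k) *\<^sub>R reflection_op \<alpha>) f"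
    by (simp add: app_divided_difference_op[OF \<alpha>])
qed

lemma divided_difference_op_one: "app (divided_difference_op \<alpha>) 1 = 0"
  by (cases "\<alpha> = 0")
    (auto simp: divided_difference_op.rep_eq intro!: divided_difference_eqI)

lemma dunkl_one: "app (dunkl m \<kappa> j) 1 = 0"
  by (simp add: dunkl_def partial_deriv_one divided_difference_op_one)

lemma dunkl_vec_one: "app (dunkl_vec m \<kappa> v) 1 = 0"
  by (simp add: dunkl_vec_def dunkl_one)

text \<open>
  The value of the commutator \<open>[D\<^sub>v, w]\<close> of a Dunkl operator with the linear form \<open>\<langle>-, w\<rangle>\<close>.
\<close>

definition dunkl_comm :: "nat \<Rightarrow> (real^3 \<Rightarrow> complex) \<Rightarrow> real^3 \<Rightarrow> real^3 \<Rightarrow> lop" where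
  "dunkl_comm m \<kappa> v w = (v \<bullet> w) *\<^sub>R 1 +
    (\<Sum>\<beta>\<in>pos_roots m. scaleC_lop (\<kappa> \<beta> * of_real (2 * (\<beta> \<bullet> v) * (\<beta> \<bullet> w))) (reflection_op \<beta>))"

lemma dunkl_comm_sym: "dunkl_comm m \<kappa> v w = dunkl_comm m \<kappa> w v"
  by (simp add: dunkl_comm_def inner_commute mult_ac)

lemma bilinear_dunkl_comm: "bilinear (dunkl_comm m \<kappa>)"
proof -
  have "linear (dunkl_comm m \<kappa> v)" for v
    by (rule linearI)
      (simp_all add: dunkl_comm_def algebra_simps scaleC_lop_add sum.distrib
        scaleC_lop_scaleR scaleR_sum_right)
  then show ?thesis
    unfolding bilinear_def using dunkl_comm_sym[of m \<kappa>] by presburger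
qed

lemma dunkl_mult_var:
  assumes "m \<ge> 1"
  shows "dunkl m \<kappa> j * mult_var k = mult_var k * dunkl m \<kappa> j + dunkl_comm m \<kappa> (axis j 1) (axis k 1)"
proof -
  have u: "\<beta> \<bullet> \<beta> = 1" if "\<beta> \<in> pos_roots m" for \<beta>
    using that pos_roots_subset[OF assms] dih_roots_unit by blast
  have "(\<Sum>\<beta>\<in>pos_roots m. scaleC_lop (\<kappa> \<beta> * of_real (\<beta> \<bullet> axis j 1)) (divided_difference_op \<beta> * mult_var k))
     = (\<Sum>\<beta>\<in>pos_roots m. scaleC_lop (\<kappa> \<beta> * of_real (\<beta> \<bullet> axis j 1)) (mult_var k * divided_difference_op \<beta>))
     + (\<Sum>\<beta>\<in>pos_roots m. scaleC_lop (\<kappa> \<beta> * of_real (2 * (\<beta> \<bullet> axis j 1) * (\<beta> \<bullet> axis k 1))) (reflection_op \<beta>))"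
    unfolding sum.distrib[symmetric]
    by (rule sum.cong)
      (simp_all add: divided_difference_op_mult_var u scaleC_lop_add scaleC_lop_scaleR inner_axis mult_ac)
  moreover have "axis j 1 \<bullet> axis k (1::real) = (if j = k then 1 else 0)"
    by (simp add: inner_axis_axis)
  ultimately show ?thesis
    by (simp add: dunkl_def dunkl_comm_def deriv_op_mult_var distrib_left distrib_right
        sum_distrib_left sum_distrib_right)
qed

lemma dunkl_vec_mult_vec:
  assumes "m \<ge> 1"
  shows "dunkl_vec m \<kappa> v * mult_vec w = mult_vec w * dunkl_vec m \<kappa> v + dunkl_comm m \<kappa> v w"
proof -
  have exp: "u = (\<Sum>k\<in>UNIV. u $ k *\<^sub>R axis k 1)" for u :: "real^3"
    using basis_expansion[of u] by (simp add: scalar_mult_eq_scaleR)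
  have "dunkl_comm m \<kappa> v w = dunkl_comm m \<kappa> (\<Sum>j\<in>UNIV. v $ j *\<^sub>R axis j 1) (\<Sum>k\<in>UNIV. w $ k *\<^sub>R axis k 1)"
    using exp by metis
  also have "\<dots> = (\<Sum>j\<in>UNIV. \<Sum>k\<in>UNIV. (v $ j * w $ k) *\<^sub>R dunkl_comm m \<kappa> (axis j 1) (axis k 1))"
    by (simp add: bilinear_sum[OF bilinear_dunkl_comm] sum.cartesian_product mult.commute
      bilinear_lmul[OF bilinear_dunkl_comm] bilinear_rmul[OF bilinear_dunkl_comm])
  finally have C: "dunkl_comm m \<kappa> v w = \<dots>" .
  have "mult_vec w * dunkl_vec m \<kappa> v =
      (\<Sum>j\<in>UNIV. \<Sum>k\<in>UNIV. (v $ j * w $ k) *\<^sub>R (mult_var k * dunkl m \<kappa> j))"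
    unfolding mult_vec_def dunkl_vec_def
    by (subst sum.swap) (simp add: sum_product mult.commute)
  then show ?thesis
    unfolding C unfolding mult_vec_def dunkl_vec_def
    by (simp add: sum_product dunkl_mult_var[OF assms] scaleR_add_right sum.distrib
        mult.commute[of "w $ _"])
qed

lemma reflection_op_dunkl_comm:
  assumes "m \<ge> 1" "orbit_invariant m \<kappa>" "\<alpha> \<in> dih_roots m"
  shows "reflection_op \<alpha> * dunkl_comm m \<kappa> v w =
    dunkl_comm m \<kappa> (reflection \<alpha> v) (reflection \<alpha> w) * reflection_op \<alpha>"
proof -
  define F where "F \<beta> = scaleC_lop (\<kappa> \<beta> * of_real (2 * (\<beta> \<bullet> reflection \<alpha> v) * (\<beta> \<bullet> reflection \<alpha> w)))
      (reflection_op \<beta> * reflection_op \<alpha>)" for \<beta>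
  have "F (- \<beta>) = F \<beta>" if "\<beta> \<in> dih_roots m" for \<beta>
    using that by (simp add: F_def orbit_invariant_uminus[OF assms(2)] reflection_op_uminus)
  from sum_pos_roots_reflection[of m \<alpha> F, OF assms(1,3) this]
  have "(\<Sum>\<beta>\<in>pos_roots m. F \<beta>) = (\<Sum>\<beta>\<in>pos_roots m. F (reflection \<alpha> \<beta>))"
    by simp
  also have "\<dots> = (\<Sum>\<beta>\<in>pos_roots m. scaleC_lop (\<kappa> \<beta> * of_real (2 * (\<beta> \<bullet> v) * (\<beta> \<bullet> w)))
      (reflection_op \<alpha> * reflection_op \<beta>))"
    using pos_roots_subset[OF assms(1)]
    by (intro sum.cong refl)
      (auto simp: F_def orbit_invariant_reflection[OF assms(2,3)] reflection_op_conj[of \<alpha>])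
  finally show ?thesis
    by (simp add: dunkl_comm_def distrib_left distrib_right sum_distrib_left sum_distrib_right F_def)
qed

text \<open>
  The difference of the two sides kills \<open>1\<close>, and by the
  equivariance of the commutators it intertwines each linear form with its reflected form, so it vanishes.
\<close>

lemma reflection_op_dunkl_vec:
  assumes "m \<ge> 1" "orbit_invariant m \<kappa>" "\<alpha> \<in> dih_roots m"
  shows "reflection_op \<alpha> * dunkl_vec m \<kappa> v = dunkl_vec m \<kappa> (reflection \<alpha> v) * reflection_op \<alpha>"
proof -
  define T where "T = reflection_op \<alpha> * dunkl_vec m \<kappa> v - dunkl_vec m \<kappa> (reflection \<alpha> v) * reflection_op \<alpha>"
  have "T * mult_vec w = mult_vec (reflection \<alpha> w) * T" for w
  proof -
    have "reflection_op \<alpha> * dunkl_vec m \<kappa> v * mult_vec w =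
        mult_vec (reflection \<alpha> w) * (reflection_op \<alpha> * dunkl_vec m \<kappa> v)
        + reflection_op \<alpha> * dunkl_comm m \<kappa> v w"
      by (simp add: mult.assoc dunkl_vec_mult_vec[OF assms(1)] distrib_left)
        (simp add: mult.assoc[symmetric] reflection_op_mult_vec)
    moreover have "dunkl_vec m \<kappa> (reflection \<alpha> v) * reflection_op \<alpha> * mult_vec w =
        mult_vec (reflection \<alpha> w) * (dunkl_vec m \<kappa> (reflection \<alpha> v) * reflection_op \<alpha>)
        + dunkl_comm m \<kappa> (reflection \<alpha> v) (reflection \<alpha> w) * reflection_op \<alpha>"
      by (simp add: mult.assoc reflection_op_mult_vec)
        (simp add: mult.assoc[symmetric] dunkl_vec_mult_vec[OF assms(1)] distrib_right)
    ultimately show ?thesis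
      unfolding T_def using reflection_op_dunkl_comm[OF assms, of v w]
      by (simp add: algebra_simps)
  qed
  then have "T * mult_var k = mult_vec (reflection \<alpha> (axis k 1)) * T" for k
    using mult_vec_axis by metis
  moreover have "app T 1 = 0"
    by (simp only: T_def app_simps dunkl_vec_one reflection_op_one app_zero_right) simp
  ultimately have "T = 0"
    by (rule lop_eq_zero_if_intertwines[rotated])
  then show ?thesis by (simp add: T_def)
qed

text \<open>
  By the Jacobi identity \<open>[[D\<^sub>v, D\<^sub>w], u]\<close> is \<open>[[D\<^sub>v, u], D\<^sub>w] - [[D\<^sub>w, u], D\<^sub>v]\<close>. Equivariance makes \<open>[[D\<^sub>v, u], D\<^sub>w]\<close> a sum over the
  roots \<open>\<beta>\<close> whose terms carry the factor \<open>\<langle>\<beta>,v\<rangle>\<langle>\<beta>,w\<rangle>\<langle>\<beta>,u\<rangle>\<close>, which is symmetric in \<open>v\<close> and \<open>w\<close>.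
  So \<open>[D\<^sub>v, D\<^sub>w]\<close> commutes with the coordinates; as it kills \<open>1\<close>, it is zero.
\<close>

lemma dunkl_vec_commute:
  assumes "m \<ge> 1" "orbit_invariant m \<kappa>"
  shows "dunkl_vec m \<kappa> v * dunkl_vec m \<kappa> w = dunkl_vec m \<kappa> w * dunkl_vec m \<kappa> v"
proof -
  note dm = dunkl_vec_mult_vec[OF assms(1)]
  \<comment> \<open>\<open>Q v w u\<close> is \<open>[[D\<^sub>v, u], D\<^sub>w]\<close>.\<close>
  define Q where "Q v w u = dunkl_comm m \<kappa> v u * dunkl_vec m \<kappa> w - dunkl_vec m \<kappa> w * dunkl_comm m \<kappa> v u" for v w u
  have Q: "Q v w u = - (\<Sum>\<beta>\<in>pos_roots m.
      scaleC_lop (\<kappa> \<beta> * of_real (4 * (\<beta> \<bullet> v) * (\<beta> \<bullet> w) * (\<beta> \<bullet> u))) (dunkl_vec m \<kappa> \<beta> * reflection_op \<beta>))" for v w u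
  proof -
    have "scaleC_lop c (reflection_op \<beta> * dunkl_vec m \<kappa> w) =
       scaleC_lop c (dunkl_vec m \<kappa> w * reflection_op \<beta>) -
         scaleC_lop (c * of_real (2 * (\<beta> \<bullet> w))) (dunkl_vec m \<kappa> \<beta> * reflection_op \<beta>)"
      if "\<beta> \<in> pos_roots m" for \<beta> c
    proof -
      have \<beta>: "\<beta> \<in> dih_roots m"
        using that pos_roots_subset[OF assms(1)] by blast
      show ?thesis
        by (simp add: reflection_op_dunkl_vec[OF assms \<beta>] reflection_unit[OF dih_roots_unit[OF \<beta>]]
            linear_diff[OF linear_dunkl_vec] linear_scale[OF linear_dunkl_vec] left_diff_distrib
            linear_diff[OF linear_scaleC_lop] scaleC_lop_scaleR mult_ac)
    qed
    then show ?thesis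
      by (simp add: Q_def dunkl_comm_def distrib_left distrib_right sum_distrib_left sum_distrib_right
          sum_subtractf mult_ac)
  qed
  define T where "T = dunkl_vec m \<kappa> v * dunkl_vec m \<kappa> w - dunkl_vec m \<kappa> w * dunkl_vec m \<kappa> v"
  have "T * mult_vec u = mult_vec u * T" for u
  proof -
    have e: "dunkl_vec m \<kappa> v * dunkl_vec m \<kappa> w * mult_vec u = mult_vec u * (dunkl_vec m \<kappa> v * dunkl_vec m \<kappa> w)
        + dunkl_comm m \<kappa> v u * dunkl_vec m \<kappa> w + dunkl_vec m \<kappa> v * dunkl_comm m \<kappa> w u" for v w
      by (simp add: mult.assoc dm distrib_left)
        (simp add: mult.assoc[symmetric] dm distrib_right)
    have "Q v w u = Q w v u"
      by (simp add: Q mult_ac)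
    then show ?thesis
      by (simp add: T_def left_diff_distrib right_diff_distrib e) (simp add: Q_def algebra_simps)
  qed
  then have "T * mult_var k = mult_var k * T" for k
    using mult_vec_axis by metis
  moreover have "app T 1 = 0"
    by (simp add: T_def dunkl_vec_one)
  ultimately have "T = 0"
    by (rule lop_eq_zero_if_intertwines[rotated])
  then show ?thesis by (simp add: T_def)
qed

section \<open>The Clifford algebra and the elements covering reflections\<close>

lemma bilinear_cl_mult:
  "bilinear (cl_mult \<epsilon> :: 'a::real_algebra_1 ^ (3 set) \<Rightarrow> 'a ^ (3 set) \<Rightarrow> 'a ^ (3 set))"
  unfolding bilinear_def
  by (auto intro!: linearI simp: vec_eq_iff cl_mult_nth algebra_simps sum.distrib scaleR_sum_right)

lemmas cl_mult_distrib =
  bilinear_ladd[OF bilinear_cl_mult] bilinear_radd[OF bilinear_cl_mult]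
  bilinear_lsub[OF bilinear_cl_mult] bilinear_rsub[OF bilinear_cl_mult]
  bilinear_lneg[OF bilinear_cl_mult] bilinear_rneg[OF bilinear_cl_mult]
  bilinear_lmul[OF bilinear_cl_mult] bilinear_rmul[OF bilinear_cl_mult]

lemma cl_mult_zero [simp]: "0 \<star>\<^bsub>\<epsilon>\<^esub> X = 0" "X \<star>\<^bsub>\<epsilon>\<^esub> 0 = 0"
  by (simp_all add: bilinear_lzero[OF bilinear_cl_mult] bilinear_rzero[OF bilinear_cl_mult])

lemma linear_cl_mult_left: "linear (\<lambda>X. X \<star>\<^bsub>\<epsilon>\<^esub> Y)"
  and linear_cl_mult_right: "linear (cl_mult \<epsilon> X)"
  using bilinear_cl_mult unfolding bilinear_def by auto

lemmas cl_mult_sum_left = linear_sum[OF linear_cl_mult_left]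
lemmas cl_mult_sum_right = linear_sum[OF linear_cl_mult_right]

lemma linear_cl_of: "linear cl_of"
  by (rule linearI) (simp_all add: cl_of_def vec_eq_iff)

lemma cl_mult_unit [simp]: "cl_of 1 \<star>\<^bsub>\<epsilon>\<^esub> X = X" "X \<star>\<^bsub>\<epsilon>\<^esub> cl_of 1 = X"
  by (simp_all add: cl_mult_of_left cl_mult_of_right)

lemma cl_gen_square: "cl_gen j \<star>\<^bsub>\<epsilon>\<^esub> cl_gen j = \<epsilon> *\<^sub>R cl_of (1::'a::real_algebra_1)"
proof -
  have "2 *\<^sub>R (cl_gen j \<star>\<^bsub>\<epsilon>\<^esub> cl_gen j) = 2 *\<^sub>R (\<epsilon> *\<^sub>R cl_of (1::'a))"
    using cl_gen_anticommute[where 'a = 'a, of \<epsilon> j j]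
    by (simp add: scaleR_2[symmetric] of_real_def linear_scale[OF linear_cl_of])
  then show ?thesis by (rule scaleR_left_imp_eq[rotated]) simp
qed

lemma cl_gen_anticommute_distinct:
  "j \<noteq> k \<Longrightarrow> cl_gen j \<star>\<^bsub>\<epsilon>\<^esub> cl_gen k = - (cl_gen k \<star>\<^bsub>\<epsilon>\<^esub> cl_gen j)"
  using cl_gen_anticommute[of \<epsilon> j k] by (simp add: eq_neg_iff_add_eq_0)

lemma distinct_3 [simp]: "(1::3) \<noteq> 2" "(1::3) \<noteq> 3" "(2::3) \<noteq> 3" "(2::3) \<noteq> 1" "(3::3) \<noteq> 1" "(3::3) \<noteq> 2"
  by simp_all

lemma cl_scaleC_mult:
  "cl_scaleC c X \<star>\<^bsub>\<epsilon>\<^esub> Y = cl_scaleC c (X \<star>\<^bsub>\<epsilon>\<^esub> Y)"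
  "X \<star>\<^bsub>\<epsilon>\<^esub> cl_scaleC c Y = cl_scaleC c (X \<star>\<^bsub>\<epsilon>\<^esub> Y)"
  by (simp_all add: vec_eq_iff cl_mult_nth cl_scaleC_def linear_sum[OF linear_scaleC_lop]
      linear_scale[OF linear_scaleC_lop])

lemma linear_cl_scaleC: "linear (cl_scaleC c)"
  by (rule linearI) (simp_all add: vec_eq_iff cl_scaleC_def linear_add[OF linear_scaleC_lop]
      linear_scale[OF linear_scaleC_lop])

lemma cl_scaleC_of: "cl_scaleC c (cl_of a) = cl_of (scaleC_lop c a)"
  by (simp add: vec_eq_iff cl_scaleC_def cl_of_def linear_0[OF linear_scaleC_lop])

lemma cl_scaleC_scaleR: "cl_scaleC c (r *\<^sub>R X) = cl_scaleC (of_real r * c) X"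
  "r *\<^sub>R cl_scaleC c X = cl_scaleC (of_real r * c) X"
  by (simp_all add: vec_eq_iff cl_scaleC_def scaleC_lop_scaleR)

definition gen_vec :: "real^3 \<Rightarrow> 'a::real_algebra_1 ^ (3 set)" where
  "gen_vec v = (\<Sum>k\<in>UNIV. v $ k *\<^sub>R cl_gen k)"

lemma linear_gen_vec: "linear gen_vec"
  by (rule linearI) (simp_all add: gen_vec_def algebra_simps sum.distrib scaleR_sum_right)

lemma gen_vec_axis: "gen_vec (axis j 1) = cl_gen j"
  unfolding gen_vec_def by (rule sum_axis_scaleR)

lemma cl_of_gen_vec_commute: "gen_vec v \<star>\<^bsub>\<epsilon>\<^esub> cl_of a = cl_of a \<star>\<^bsub>\<epsilon>\<^esub> gen_vec v"
  by (simp add: gen_vec_def cl_mult_sum_left cl_mult_sum_right cl_mult_distrib cl_of_gen_commute)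

lemma gen_vec_anticommute:
  "gen_vec v \<star>\<^bsub>\<epsilon>\<^esub> gen_vec w + gen_vec w \<star>\<^bsub>\<epsilon>\<^esub> gen_vec v = (2 * \<epsilon> * (v \<bullet> w)) *\<^sub>R cl_of (1::'a::real_algebra_1)"
proof -
  have e: "cl_gen j \<star>\<^bsub>\<epsilon>\<^esub> cl_gen k + cl_gen k \<star>\<^bsub>\<epsilon>\<^esub> cl_gen j =
      (if j = k then (2 * \<epsilon>) *\<^sub>R cl_of (1::'a) else 0)" for j k
    by (simp add: cl_gen_anticommute of_real_def linear_scale[OF linear_cl_of])
  have "gen_vec v \<star>\<^bsub>\<epsilon>\<^esub> gen_vec w + gen_vec w \<star>\<^bsub>\<epsilon>\<^esub> gen_vec v =
      (\<Sum>k\<in>UNIV. \<Sum>j\<in>UNIV. (v $ j * w $ k) *\<^sub>R (cl_gen j \<star>\<^bsub>\<epsilon>\<^esub> cl_gen k))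
      + (\<Sum>j\<in>UNIV. \<Sum>k\<in>UNIV. (v $ j * w $ k) *\<^sub>R (cl_gen k \<star>\<^bsub>\<epsilon>\<^esub> cl_gen j :: 'a ^ (3 set)))"
    by (simp add: gen_vec_def cl_mult_sum_left cl_mult_sum_right cl_mult_distrib scaleR_sum_right
        mult.commute)
  also have "\<dots> = (\<Sum>j\<in>UNIV. \<Sum>k\<in>UNIV. (v $ j * w $ k) *\<^sub>R
      (cl_gen j \<star>\<^bsub>\<epsilon>\<^esub> cl_gen k + cl_gen k \<star>\<^bsub>\<epsilon>\<^esub> cl_gen j))"
    by (subst sum.swap) (simp only: scaleR_add_right sum.distrib)
  also have "\<dots> = (\<Sum>j\<in>UNIV. \<Sum>k\<in>UNIV. if j = k then (v $ j * w $ k) *\<^sub>R (2 * \<epsilon>) *\<^sub>R cl_of 1 else 0)"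
    unfolding e by (intro sum.cong) auto
  also have "\<dots> = (2 * \<epsilon> * (v \<bullet> w)) *\<^sub>R cl_of 1"
    by (simp add: inner_vec_def scaleR_sum_left[symmetric] sum_distrib_left mult_ac)
  finally show ?thesis .
qed

lemma gen_vec_square: "gen_vec v \<star>\<^bsub>\<epsilon>\<^esub> gen_vec v = (\<epsilon> * (v \<bullet> v)) *\<^sub>R cl_of (1::'a::real_algebra_1)"
proof -
  have "2 *\<^sub>R (gen_vec v \<star>\<^bsub>\<epsilon>\<^esub> gen_vec v) = 2 *\<^sub>R ((\<epsilon> * (v \<bullet> v)) *\<^sub>R cl_of (1::'a))"
    using gen_vec_anticommute[where 'a = 'a, of \<epsilon> v v] by (simp add: scaleR_2[symmetric])
  then show ?thesis by (rule scaleR_left_imp_eq[rotated]) simp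
qed

lemma gen_vec_reflection:
  assumes "\<alpha> \<bullet> \<alpha> = 1"
  shows "gen_vec \<alpha> \<star>\<^bsub>\<epsilon>\<^esub> gen_vec v = - (gen_vec (reflection \<alpha> v) \<star>\<^bsub>\<epsilon>\<^esub> gen_vec \<alpha>)"
  using gen_vec_anticommute[of \<epsilon> \<alpha> v]
  by (simp add: reflection_unit[OF assms] linear_diff[OF linear_gen_vec] linear_scale[OF linear_gen_vec]
     cl_mult_distrib gen_vec_square assms algebra_simps eq_diff_eq)

lemma sigma_tilde_eq: "sigma_tilde \<epsilon> \<alpha> = cl_of (reflection_op \<alpha>) \<star>\<^bsub>\<epsilon>\<^esub> gen_vec \<alpha>"
  by (simp add: sigma_tilde_def gen_vec_def inner_axis)

text \<open>
  The tensor \<open>\<Sum> \<xi>\<^sub>k \<otimes> \<xi>\<^sub>k\<close> is invariant under orthogonal maps.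
\<close>

lemma sum_reflection_orthonormal:
  fixes B :: "real^3 \<Rightarrow> real^3 \<Rightarrow> 'b::real_vector"
  assumes "bilinear B" "\<alpha> \<bullet> \<alpha> = 1"
  shows "(\<Sum>k\<in>UNIV. B (reflection \<alpha> (axis k 1)) (reflection \<alpha> (axis k 1))) =
    (\<Sum>k\<in>UNIV. B (axis k 1) (axis k 1))"
proof -
  have \<alpha>: "\<alpha> = (\<Sum>k\<in>UNIV. \<alpha> $ k *\<^sub>R axis k 1)"
    using basis_expansion[of \<alpha>] by (simp add: scalar_mult_eq_scaleR)
  have lin: "linear (\<lambda>x. B x \<alpha>)" "linear (B \<alpha>)"
    using assms(1) by (auto simp: bilinear_def)
  have l: "B \<alpha> \<alpha> = (\<Sum>k\<in>UNIV. \<alpha> $ k *\<^sub>R B (axis k 1) \<alpha>)"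
    using arg_cong[OF \<alpha>, of "\<lambda>x. B x \<alpha>"] by (simp add: linear_sum[OF lin(1)] linear_scale[OF lin(1)])
  have r: "B \<alpha> \<alpha> = (\<Sum>k\<in>UNIV. \<alpha> $ k *\<^sub>R B \<alpha> (axis k 1))"
    using arg_cong[OF \<alpha>, of "B \<alpha>"] by (simp add: linear_sum[OF lin(2)] linear_scale[OF lin(2)])
  have n: "(\<Sum>k\<in>UNIV. (\<alpha> $ k * \<alpha> $ k) *\<^sub>R B \<alpha> \<alpha>) = B \<alpha> \<alpha>"
    using assms(2) by (simp add: scaleR_sum_left[symmetric] inner_vec_def)
  have "(\<Sum>k\<in>UNIV. B (reflection \<alpha> (axis k 1)) (reflection \<alpha> (axis k 1))) =
     (\<Sum>k\<in>UNIV. B (axis k 1) (axis k 1)) - 2 *\<^sub>R (\<Sum>k\<in>UNIV. \<alpha> $ k *\<^sub>R B (axis k 1) \<alpha>)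
     - 2 *\<^sub>R (\<Sum>k\<in>UNIV. \<alpha> $ k *\<^sub>R B \<alpha> (axis k 1)) + 4 *\<^sub>R (\<Sum>k\<in>UNIV. (\<alpha> $ k * \<alpha> $ k) *\<^sub>R B \<alpha> \<alpha>)"
    unfolding scaleR_sum_right sum_subtractf[symmetric] sum.distrib[symmetric]
    by (intro sum.cong refl)
      (simp add: reflection_unit[OF assms(2)] inner_axis bilinear_lsub[OF assms(1)]
        bilinear_rsub[OF assms(1)] bilinear_lmul[OF assms(1)] bilinear_rmul[OF assms(1)] algebra_simps)
  also have "\<dots> = (\<Sum>k\<in>UNIV. B (axis k 1) (axis k 1)) + (4 - 2 - 2) *\<^sub>R B \<alpha> \<alpha>"
    unfolding n by (simp only: scaleR_diff_left flip: l r) simp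
  finally show ?thesis by simp
qed

text \<open>
  Both the Dunkl--Dirac operator and the vector variable \<open>x\<^sub>1e\<^sub>1 + x\<^sub>2e\<^sub>2 + x\<^sub>3e\<^sub>3\<close> are of
  this form; invariance under reflections can thus be treated for both at once.
\<close>

definition cl_trace :: "real \<Rightarrow> (real^3 \<Rightarrow> lop) \<Rightarrow> lop ^ (3 set)" where
  "cl_trace \<epsilon> F = (\<Sum>k\<in>UNIV. cl_of (F (axis k 1)) \<star>\<^bsub>\<epsilon>\<^esub> cl_gen k)"

text \<open>
  The sign comes from the Clifford algebra, where a unit vector \<open>\<alpha>\<close> satisfies
  \<open>\<alpha> v = - \<sigma>\<^sub>\<alpha>(v) \<alpha>\<close>.
\<close>

lemma sigma_tilde_of_gen_vec:
  assumes "\<alpha> \<bullet> \<alpha> = 1"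
    and "reflection_op \<alpha> * a = b * reflection_op \<alpha>"
  shows "sigma_tilde \<epsilon> \<alpha> \<star>\<^bsub>\<epsilon>\<^esub> (cl_of a \<star>\<^bsub>\<epsilon>\<^esub> gen_vec v) =
    - (cl_of b \<star>\<^bsub>\<epsilon>\<^esub> gen_vec (reflection \<alpha> v) \<star>\<^bsub>\<epsilon>\<^esub> sigma_tilde \<epsilon> \<alpha>)"
proof -
  have "sigma_tilde \<epsilon> \<alpha> \<star>\<^bsub>\<epsilon>\<^esub> (cl_of a \<star>\<^bsub>\<epsilon>\<^esub> gen_vec v) =
      cl_of (reflection_op \<alpha>) \<star>\<^bsub>\<epsilon>\<^esub> (gen_vec \<alpha> \<star>\<^bsub>\<epsilon>\<^esub> cl_of a) \<star>\<^bsub>\<epsilon>\<^esub> gen_vec v"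
    by (simp add: sigma_tilde_eq cl_mult_assoc)
  also have "\<dots> = cl_of (reflection_op \<alpha> * a) \<star>\<^bsub>\<epsilon>\<^esub> (gen_vec \<alpha> \<star>\<^bsub>\<epsilon>\<^esub> gen_vec v)"
    by (simp add: cl_of_gen_vec_commute cl_mult_assoc cl_of_mult[of _ _ \<epsilon>])
  also have "\<dots> = - (cl_of b \<star>\<^bsub>\<epsilon>\<^esub> (cl_of (reflection_op \<alpha>) \<star>\<^bsub>\<epsilon>\<^esub> gen_vec (reflection \<alpha> v)) \<star>\<^bsub>\<epsilon>\<^esub> gen_vec \<alpha>)"
    unfolding gen_vec_reflection[OF assms(1)] assms(2)
    by (simp add: cl_mult_distrib cl_mult_assoc cl_of_mult[of _ _ \<epsilon>])
  also have "\<dots> = - (cl_of b \<star>\<^bsub>\<epsilon>\<^esub> gen_vec (reflection \<alpha> v) \<star>\<^bsub>\<epsilon>\<^esub> sigma_tilde \<epsilon> \<alpha>)"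
    by (simp add: sigma_tilde_eq cl_mult_assoc flip: cl_of_gen_vec_commute[of _ _ "reflection_op \<alpha>"])
  finally show ?thesis .
qed

lemma sigma_tilde_cl_trace:
  assumes "\<alpha> \<bullet> \<alpha> = 1" "linear F"
    and F: "\<And>v. reflection_op \<alpha> * F v = F (reflection \<alpha> v) * reflection_op \<alpha>"
  shows "sigma_tilde \<epsilon> \<alpha> \<star>\<^bsub>\<epsilon>\<^esub> cl_trace \<epsilon> F = - (cl_trace \<epsilon> F \<star>\<^bsub>\<epsilon>\<^esub> sigma_tilde \<epsilon> \<alpha>)"
proof -
  have "bilinear (\<lambda>v w. cl_of (F v) \<star>\<^bsub>\<epsilon>\<^esub> gen_vec w)"
    unfolding bilinear_def
    by (auto intro!: linearI simp: linear_add[OF assms(2)] linear_scale[OF assms(2)]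
        linear_add[OF linear_cl_of] linear_scale[OF linear_cl_of] linear_add[OF linear_gen_vec]
        linear_scale[OF linear_gen_vec] cl_mult_distrib)
  note eq = sum_reflection_orthonormal[OF this assms(1)]
  have "sigma_tilde \<epsilon> \<alpha> \<star>\<^bsub>\<epsilon>\<^esub> cl_trace \<epsilon> F =
    - ((\<Sum>k\<in>UNIV. cl_of (F (reflection \<alpha> (axis k 1))) \<star>\<^bsub>\<epsilon>\<^esub> gen_vec (reflection \<alpha> (axis k 1)))
       \<star>\<^bsub>\<epsilon>\<^esub> sigma_tilde \<epsilon> \<alpha>)"
    by (simp add: cl_trace_def cl_mult_sum_right cl_mult_sum_left sum_negf
        sigma_tilde_of_gen_vec[OF assms(1) F] flip: gen_vec_axis)
  then show ?thesis
    unfolding eq by (simp add: cl_trace_def gen_vec_axis)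
qed

section \<open>Relations with the Dirac operator and the vector variable\<close>

locale dihedral_dunkl_dirac =
  fixes m :: nat and \<epsilon> :: real and \<kappa> :: "real^3 \<Rightarrow> complex"
  assumes m: "m \<ge> 1" and eps: "\<epsilon> \<in> {-1, 1}" and inv: "orbit_invariant m \<kappa>"
begin

text \<open>
  \<open>O1\<close>, \<open>O2\<close>, \<open>O3\<close> are the one-, two- and three-index symmetries; \<open>Xvec\<close> is the vector variable,
  \<open>CDx i j\<close> and \<open>CDirac j\<close> are the commutators of \<open>x\<^sub>j\<close> with the i-th Dunkl
  operator and with the Dunkl--Dirac operator, and \<open>\<omega>\<close> is the pseudoscalar \<open>e\<^sub>1e\<^sub>2e\<^sub>3\<close>.
\<close>

abbreviation prod (infixl "\<star>" 70) where "X \<star> Y \<equiv> cl_mult \<epsilon> X (Y :: lop ^ (3 set))"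
abbreviation xvar where "xvar j \<equiv> cl_of (mult_var j)"
abbreviation dvar where "dvar j \<equiv> cl_of (dunkl m \<kappa> j)"
abbreviation gen :: "3 \<Rightarrow> lop ^ (3 set)" where "gen \<equiv> cl_gen"
abbreviation O1 where "O1 \<equiv> sym1 m \<kappa> \<epsilon>"
abbreviation O2 where "O2 \<equiv> sym2 m \<kappa> \<epsilon>"
abbreviation O3 where "O3 \<equiv> sym3 m \<kappa> \<epsilon>"
abbreviation Dirac where "Dirac \<equiv> dunkl_dirac m \<kappa> \<epsilon>"
abbreviation com where "com X Y \<equiv> cl_comm \<epsilon> X (Y :: lop ^ (3 set))"
definition acom where "acom X Y = X \<star> Y + Y \<star> X"
definition Xvec where "Xvec = cl_trace \<epsilon> mult_vec"
definition CDx where "CDx i j = cl_of (dunkl_comm m \<kappa> (axis i 1) (axis j 1))"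
definition CDirac where "CDirac j = (\<Sum>k\<in>UNIV. CDx k j \<star> gen k)"
definition \<omega> where "\<omega> = gen 1 \<star> gen 2 \<star> gen 3"

lemma eps_sq [simp]: "\<epsilon> * \<epsilon> = 1" "\<epsilon> * (\<epsilon> * r) = r" "\<epsilon> * (r * \<epsilon>) = r"
  using eps by auto

lemma CDx_sym: "CDx i j = CDx j i"
  by (simp add: CDx_def dunkl_comm_sym)

lemma Dirac_eq: "Dirac = cl_trace \<epsilon> (dunkl_vec m \<kappa>)"
  by (simp add: dunkl_dirac_def cl_trace_def dunkl_vec_axis)

lemma Dirac_sum: "Dirac = (\<Sum>k\<in>UNIV. dvar k \<star> gen k)"
  by (simp add: dunkl_dirac_def)

lemma Xvec_sum: "Xvec = (\<Sum>k\<in>UNIV. xvar k \<star> gen k)"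
  by (simp add: Xvec_def cl_trace_def mult_vec_axis)

lemma gen_of: "gen k \<star> cl_of a = cl_of a \<star> gen k"
  by (simp add: cl_of_gen_commute)

lemma gen_of_left: "gen k \<star> (cl_of a \<star> Y) = cl_of a \<star> (gen k \<star> Y)"
  by (metis gen_of cl_mult_assoc)

lemma dvar_xvar: "dvar j \<star> xvar k = xvar k \<star> dvar j + CDx j k"
  by (simp add: CDx_def dunkl_mult_var[OF m] linear_add[OF linear_cl_of] flip: cl_of_mult)

lemma xvar_xvar: "xvar j \<star> xvar k = xvar k \<star> xvar j"
  using mult_vec_commute[of "axis j 1" "axis k 1"] by (simp add: mult_vec_axis flip: cl_of_mult)

lemma dvar_dvar: "dvar j \<star> dvar k = dvar k \<star> dvar j"
  using dunkl_vec_commute[OF m inv, of "axis j 1" "axis k 1"]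
  by (simp add: dunkl_vec_axis flip: cl_of_mult)

lemma com_Dirac_xvar: "com Dirac (xvar j) = CDirac j"
proof -
  have "Dirac \<star> xvar j = (\<Sum>k\<in>UNIV. (dvar k \<star> xvar j) \<star> gen k)"
    by (simp add: Dirac_sum cl_mult_sum_left cl_mult_assoc gen_of)
  then show ?thesis
    by (simp add: cl_comm_def Dirac_sum CDirac_def dvar_xvar cl_mult_sum_right cl_mult_distrib
        sum.distrib cl_mult_assoc)
qed

lemma com_dvar_Xvec: "com (dvar j) Xvec = CDirac j"
proof -
  have "dvar j \<star> Xvec = (\<Sum>k\<in>UNIV. (dvar j \<star> xvar k) \<star> gen k)"
    by (simp add: Xvec_sum cl_mult_sum_right cl_mult_assoc)
  then show ?thesis
    by (simp add: cl_comm_def Xvec_sum CDirac_def dvar_xvar cl_mult_sum_left cl_mult_distrib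
        sum.distrib cl_mult_assoc gen_of CDx_sym[of j])
qed

lemma xvar_Xvec_commute: "xvar j \<star> Xvec = Xvec \<star> xvar j"
  by (simp add: Xvec_sum cl_mult_sum_left cl_mult_sum_right cl_mult_assoc gen_of)
    (simp add: xvar_xvar[of j] flip: cl_mult_assoc)

lemma dvar_Dirac_commute: "dvar j \<star> Dirac = Dirac \<star> dvar j"
  by (simp add: Dirac_sum cl_mult_sum_left cl_mult_sum_right cl_mult_assoc gen_of)
    (simp add: dvar_dvar[of j] flip: cl_mult_assoc)

lemma gen_acom: "gen j \<star> gen k + gen k \<star> gen j = (if j = k then 2 * \<epsilon> else 0) *\<^sub>R cl_of 1"
  by (simp add: cl_gen_anticommute of_real_def linear_scale[OF linear_cl_of])

lemma acom_gen_trace: "acom (\<Sum>k\<in>UNIV. cl_of (a k) \<star> gen k) (gen j) = (2 * \<epsilon>) *\<^sub>R cl_of (a j)"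
proof -
  have "acom (\<Sum>k\<in>UNIV. cl_of (a k) \<star> gen k) (gen j) =
     (\<Sum>k\<in>UNIV. cl_of (a k) \<star> (gen k \<star> gen j + gen j \<star> gen k))"
    by (simp add: acom_def cl_mult_sum_left cl_mult_sum_right cl_mult_distrib sum.distrib
        cl_mult_assoc gen_of_left)
  also have "\<dots> = (\<Sum>k\<in>UNIV. if k = j then (2 * \<epsilon>) *\<^sub>R cl_of (a k) else 0)"
    unfolding gen_acom by (intro sum.cong) (auto simp: cl_mult_distrib)
  finally show ?thesis by simp
qed

lemma acom_Dirac_gen: "acom Dirac (gen j) = (2 * \<epsilon>) *\<^sub>R dvar j"
  and acom_Xvec_gen: "acom Xvec (gen j) = (2 * \<epsilon>) *\<^sub>R xvar j"
  and acom_CDirac_gen: "acom (CDirac i) (gen j) = (2 * \<epsilon>) *\<^sub>R CDx i j"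
  unfolding Dirac_sum Xvec_sum CDirac_def CDx_def acom_gen_trace dunkl_comm_sym[of m \<kappa> "axis i 1"] by simp_all

lemma O1_eq: "O1 j = (\<epsilon> / 2) *\<^sub>R (CDirac j - gen j)"
  by (simp add: sym1_def com_Dirac_xvar)

lemma CDirac_eq: "CDirac j = (2 * \<epsilon>) *\<^sub>R O1 j + gen j"
  by (simp add: O1_eq)

text \<open>
  The one-index symmetries are combinations of the elements covering the reflections. It follows
  that they inherit the anticommutation of the latter with the Dirac operator and the vector variable.
\<close>

lemma O1_eq_sum_sigma_tilde:
  "O1 j = (\<Sum>\<beta>\<in>pos_roots m. cl_scaleC (of_real (\<epsilon> * \<beta> $ j) * \<kappa> \<beta>) (sigma_tilde \<epsilon> \<beta>))"
proof -
  have "CDx k j \<star> gen k = (axis k (1::real) \<bullet> axis j 1) *\<^sub>R gen k + (\<Sum>\<beta>\<in>pos_roots m.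
      cl_scaleC (of_real (2 * \<beta> $ j) * \<kappa> \<beta>) (cl_of (reflection_op \<beta>) \<star> (\<beta> $ k *\<^sub>R gen k)))" for k
    by (simp add: CDx_def dunkl_comm_def linear_add[OF linear_cl_of] linear_scale[OF linear_cl_of]
        linear_sum[OF linear_cl_of] cl_mult_distrib cl_mult_sum_left cl_scaleC_mult cl_scaleC_scaleR
        inner_axis mult_ac flip: cl_scaleC_of)
  then have "CDirac j = (\<Sum>k\<in>UNIV. (axis k (1::real) \<bullet> axis j 1) *\<^sub>R gen k) + (\<Sum>k\<in>UNIV. \<Sum>\<beta>\<in>pos_roots m.
      cl_scaleC (of_real (2 * \<beta> $ j) * \<kappa> \<beta>) (cl_of (reflection_op \<beta>) \<star> (\<beta> $ k *\<^sub>R gen k)))"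
    by (simp only: CDirac_def sum.distrib)
  also have "(\<Sum>k\<in>UNIV. (axis k (1::real) \<bullet> axis j 1) *\<^sub>R gen k) = gen j"
    using gen_vec_axis[of j] by (simp add: gen_vec_def inner_axis' inner_commute)
  also have "(\<Sum>k\<in>UNIV. \<Sum>\<beta>\<in>pos_roots m.
      cl_scaleC (of_real (2 * \<beta> $ j) * \<kappa> \<beta>) (cl_of (reflection_op \<beta>) \<star> (\<beta> $ k *\<^sub>R gen k))) =
      (\<Sum>\<beta>\<in>pos_roots m. cl_scaleC (of_real (2 * \<beta> $ j) * \<kappa> \<beta>) (sigma_tilde \<epsilon> \<beta>))"
    unfolding sigma_tilde_eq gen_vec_def
    by (subst sum.swap) (simp only: cl_mult_sum_right linear_sum[OF linear_cl_scaleC])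
  finally show ?thesis
    by (simp add: O1_eq scaleR_sum_right cl_scaleC_scaleR mult_ac)
qed

lemma sigma_tilde_Xvec: "\<alpha> \<in> dih_roots m \<Longrightarrow> sigma_tilde \<epsilon> \<alpha> \<star> Xvec = - (Xvec \<star> sigma_tilde \<epsilon> \<alpha>)"
  unfolding Xvec_def
  by (intro sigma_tilde_cl_trace dih_roots_unit linear_mult_vec reflection_op_mult_vec)

lemma sigma_tilde_Dirac: "\<alpha> \<in> dih_roots m \<Longrightarrow> sigma_tilde \<epsilon> \<alpha> \<star> Dirac = - (Dirac \<star> sigma_tilde \<epsilon> \<alpha>)"
  unfolding Dirac_eq
  by (intro sigma_tilde_cl_trace dih_roots_unit linear_dunkl_vec reflection_op_dunkl_vec m inv)

lemma O1_anticommute: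
  assumes "\<And>\<alpha>. \<alpha> \<in> dih_roots m \<Longrightarrow> sigma_tilde \<epsilon> \<alpha> \<star> Y = - (Y \<star> sigma_tilde \<epsilon> \<alpha>)"
  shows "O1 j \<star> Y = - (Y \<star> O1 j)"
  unfolding O1_eq_sum_sigma_tilde cl_mult_sum_left cl_mult_sum_right sum_negf[symmetric]
  using assms pos_roots_subset[OF m]
  by (intro sum.cong refl) (auto simp: cl_scaleC_mult linear_neg[OF linear_cl_scaleC])

lemmas O1_Xvec = O1_anticommute[OF sigma_tilde_Xvec]
lemmas O1_Dirac = O1_anticommute[OF sigma_tilde_Dirac]

lemma eps_2: "(\<epsilon> * 2) *\<^sub>R X = \<epsilon> *\<^sub>R X + \<epsilon> *\<^sub>R (X :: lop ^ (3 set))"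
  by (simp flip: scaleR_add_left)

text \<open>
  Products are kept associated to the right. This turns a rule for \<open>A \<star> B\<close> into the
  corresponding rule for \<open>A \<star> B\<close> followed by another factor.
\<close>

lemma mult_tail: "A \<star> B = C \<Longrightarrow> A \<star> (B \<star> Y) = C \<star> Y"
  by (simp flip: cl_mult_assoc)

text \<open>
  The Jacobi identity for \<open>[[D, x\<^sub>i], x\<^sub>j]\<close>, where \<open>D\<close> is the Dirac operator and the variables commute.
\<close>

lemma O1_xvar: "O1 i \<star> xvar j - xvar j \<star> O1 i = O1 j \<star> xvar i - xvar i \<star> O1 j"
proof -
  have "com (com Dirac (xvar i)) (xvar j) = com (com Dirac (xvar j)) (xvar i)"
    using xvar_xvar[of i j] mult_tail[OF xvar_xvar[of i j]]
    by (simp add: cl_comm_def cl_mult_distrib cl_mult_assoc)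
  then have "com (CDirac i - gen i) (xvar j) = com (CDirac j - gen j) (xvar i)"
    unfolding com_Dirac_xvar by (simp add: cl_comm_def cl_mult_distrib gen_of algebra_simps)
  then show ?thesis
    by (simp add: O1_eq cl_comm_def cl_mult_distrib flip: scaleR_diff_right)
qed

lemma gen_Xvec: "gen j \<star> Xvec = (2 * \<epsilon>) *\<^sub>R xvar j - Xvec \<star> gen j"
  and gen_Dirac: "gen j \<star> Dirac = (2 * \<epsilon>) *\<^sub>R dvar j - Dirac \<star> gen j"
  using acom_Xvec_gen[of j] acom_Dirac_gen[of j] by (simp_all add: acom_def algebra_simps eq_diff_eq)

lemma dvar_Xvec: "dvar j \<star> Xvec = Xvec \<star> dvar j + (2 * \<epsilon>) *\<^sub>R O1 j + gen j"
  using com_dvar_Xvec[of j] by (simp add: cl_comm_def CDirac_eq algebra_simps)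

lemma xvar_Dirac: "xvar j \<star> Dirac = Dirac \<star> xvar j - (2 * \<epsilon>) *\<^sub>R O1 j - gen j"
  using com_Dirac_xvar[of j] by (simp add: cl_comm_def CDirac_eq algebra_simps)

text \<open>
  Most identities below are stated for a multiple of the symmetry in question, which clears the
  denominators.
\<close>

lemma O2_double: "2 *\<^sub>R O2 i j = 2 *\<^sub>R (xvar i \<star> dvar j) - 2 *\<^sub>R (xvar j \<star> dvar i) + \<epsilon> *\<^sub>R (gen i \<star> gen j)
   + 2 *\<^sub>R (O1 i \<star> gen j) - 2 *\<^sub>R (O1 j \<star> gen i)"
  by (simp add: sym2_def dunkl_ang_def linear_diff[OF linear_cl_of] cl_of_mult[of _ _ \<epsilon>] scaleR_add_right scaleR_diff_right)

text \<open>
  That the two-index symmetries commute with the vector variable and, below, with the Dirac operator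
  is what makes all further computations short: \<open>[L\<^sub>i\<^sub>j, x]\<close> is a combination of commutators
  \<open>[D\<^sub>j, x]\<close>, which contain \<open>2\<epsilon> O\<^sub>j\<close>, and the terms \<open>O\<^sub>i e\<^sub>j\<close> contribute the opposite.
\<close>

lemma O2_Xvec: "O2 i j \<star> Xvec = Xvec \<star> O2 i j"
proof -
  have J: "O1 i \<star> xvar j = O1 j \<star> xvar i + xvar j \<star> O1 i - xvar i \<star> O1 j"
    using O1_xvar[of i j] by (simp add: algebra_simps)
  have "(2 *\<^sub>R O2 i j) \<star> Xvec = Xvec \<star> (2 *\<^sub>R O2 i j)"
    unfolding O2_double
    by (simp add: cl_mult_distrib cl_mult_assoc gen_Xvec mult_tail[OF gen_Xvec] dvar_Xvec xvar_Xvec_commute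
        mult_tail[OF xvar_Xvec_commute] O1_Xvec mult_tail[OF O1_Xvec] gen_of J scaleR_add_right scaleR_diff_right algebra_simps)
  then show ?thesis
    by (simp add: cl_mult_distrib)
qed

lemma O2_Dirac: "O2 i j \<star> Dirac = Dirac \<star> O2 i j"
proof -
  have "(2 *\<^sub>R O2 i j) \<star> Dirac = Dirac \<star> (2 *\<^sub>R O2 i j)"
    unfolding O2_double
    by (simp add: cl_mult_distrib cl_mult_assoc gen_Dirac mult_tail[OF gen_Dirac] xvar_Dirac dvar_Dirac_commute
        mult_tail[OF xvar_Dirac] O1_Dirac mult_tail[OF O1_Dirac] gen_of scaleR_add_right scaleR_diff_right algebra_simps)
  then show ?thesis
    by (simp add: cl_mult_distrib)
qed

section \<open>The three-index symmetry as a Scasimir element\<close>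

definition cyclic :: "3 \<Rightarrow> 3 \<Rightarrow> 3 \<Rightarrow> bool" where
  "cyclic i j k \<longleftrightarrow> (i, j, k) \<in> {(1, 2, 3), (2, 3, 1), (3, 1, 2)}"

lemma cyclic_rotate: "cyclic i j k \<Longrightarrow> cyclic j k i"
  by (auto simp: cyclic_def)

lemma gen_square: "gen j \<star> gen j = \<epsilon> *\<^sub>R cl_of 1"
  by (rule cl_gen_square)

text \<open>
  Normal forms in the tensor product: coefficients to the left, Clifford generators in increasing
  order.
\<close>

lemmas gen_sort = cl_gen_anticommute_distinct[OF distinct_3(4)]
  cl_gen_anticommute_distinct[OF distinct_3(5)] cl_gen_anticommute_distinct[OF distinct_3(6)]

lemmas gen_normalize = cl_mult_distrib cl_mult_assoc gen_square mult_tail[OF gen_square]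
  gen_sort mult_tail[OF gen_sort(1)] mult_tail[OF gen_sort(2)] mult_tail[OF gen_sort(3)] gen_of gen_of_left

lemma omega_square: "\<omega> \<star> \<omega> = - (\<epsilon> *\<^sub>R cl_of 1)"
  by (simp add: \<omega>_def gen_normalize)

text \<open>
  In odd dimension the pseudoscalar is central.
\<close>

lemma gen_omega: "gen j \<star> \<omega> = \<omega> \<star> gen j"
  using exhaust_3[of j] by (auto simp: \<omega>_def gen_normalize)

lemma of_omega: "cl_of a \<star> \<omega> = \<omega> \<star> cl_of a"
  by (simp add: \<omega>_def gen_normalize)

lemma cyclic_gen: "cyclic i j k \<Longrightarrow> gen i \<star> gen j = \<epsilon> *\<^sub>R (\<omega> \<star> gen k)"
  by (auto simp: cyclic_def \<omega>_def gen_normalize)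

lemma omega_mult: "X \<star> \<omega> = \<omega> \<star> X \<Longrightarrow> Y \<star> \<omega> = \<omega> \<star> Y \<Longrightarrow> (X \<star> Y) \<star> \<omega> = \<omega> \<star> (X \<star> Y)"
  by (metis cl_mult_assoc)

lemma CDirac_omega: "CDirac j \<star> \<omega> = \<omega> \<star> CDirac j" and Dirac_omega: "Dirac \<star> \<omega> = \<omega> \<star> Dirac" and Xvec_omega: "Xvec \<star> \<omega> = \<omega> \<star> Xvec"
  by (simp_all add: CDirac_def Dirac_sum Xvec_sum CDx_def cl_mult_sum_left cl_mult_sum_right omega_mult of_omega gen_omega)

lemma O1_omega: "O1 j \<star> \<omega> = \<omega> \<star> O1 j"
  by (simp add: O1_eq cl_mult_distrib CDirac_omega gen_omega)

lemma O2_omega: "O2 i j \<star> \<omega> = \<omega> \<star> O2 i j"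
  by (simp add: sym2_def cl_mult_distrib of_omega omega_mult gen_omega O1_omega)

definition ang where "ang i j = cl_of (dunkl_ang m \<kappa> i j)"

lemma ang_eq: "ang i j = xvar i \<star> dvar j - xvar j \<star> dvar i"
  by (simp add: ang_def dunkl_ang_def linear_diff[OF linear_cl_of] cl_of_mult[of _ _ \<epsilon>])

lemma O2_double_CDirac:
  assumes "i \<noteq> j"
  shows "2 *\<^sub>R O2 i j = 2 *\<^sub>R ang i j + \<epsilon> *\<^sub>R (CDirac i \<star> gen j - CDirac j \<star> gen i - gen i \<star> gen j)"
  unfolding O2_double ang_eq O1_eq
  by (simp add: cl_mult_distrib cl_gen_anticommute_distinct[OF assms[symmetric]] algebra_simps)

lemma O3_double_CDirac: "2 *\<^sub>R O3 = 2 *\<^sub>R (ang 1 2 \<star> gen 3 + ang 3 1 \<star> gen 2 + ang 2 3 \<star> gen 1)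
    + \<epsilon> *\<^sub>R (CDirac 1 \<star> gen 2 \<star> gen 3 + CDirac 2 \<star> gen 3 \<star> gen 1 + CDirac 3 \<star> gen 1 \<star> gen 2 - \<omega>)"
proof -
  have "2 *\<^sub>R O3 = - (\<epsilon> *\<^sub>R \<omega>) - (2 *\<^sub>R O1 1) \<star> gen 2 \<star> gen 3 - (2 *\<^sub>R O1 2) \<star> gen 3 \<star> gen 1
     - (2 *\<^sub>R O1 3) \<star> gen 1 \<star> gen 2 + (2 *\<^sub>R O2 1 2) \<star> gen 3 + (2 *\<^sub>R O2 3 1) \<star> gen 2 + (2 *\<^sub>R O2 2 3) \<star> gen 1"
    by (simp add: sym3_def \<omega>_def cl_mult_distrib scaleR_add_right scaleR_diff_right)
  then show ?thesis
    by (simp add: O2_double_CDirac O1_eq \<omega>_def gen_normalize algebra_simps)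
qed

text \<open>
  Up to the central factor \<open>\<omega>\<close>, the three-index symmetry is the Scasimir element
  \<open>([D, x] - \<epsilon>)/2\<close> of the Lie superalgebra osp(1|2) generated by the Dirac operator and the vector
  variable. Anything that commutes with both, or anticommutes with both, therefore commutes with it.
\<close>

lemma O3_eq: "2 *\<^sub>R O3 = (com Dirac Xvec - \<epsilon> *\<^sub>R cl_of 1) \<star> \<omega>"
proof -
  have DX: "Dirac \<star> xvar k = xvar k \<star> Dirac + CDirac k" for k
    using com_Dirac_xvar[of k] by (simp add: cl_comm_def algebra_simps)
  have "com Dirac Xvec \<star> \<omega> = (\<Sum>k\<in>UNIV. CDirac k \<star> gen k \<star> \<omega>) + (\<Sum>k\<in>UNIV. xvar k \<star> com Dirac (gen k) \<star> \<omega>)"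
    by (simp add: Xvec_sum cl_comm_def cl_mult_sum_left cl_mult_sum_right cl_mult_distrib
      mult_tail[OF DX] cl_mult_assoc sum.distrib sum_subtractf)
  also have "(\<Sum>k\<in>UNIV. CDirac k \<star> gen k \<star> \<omega>) = \<epsilon> *\<^sub>R (CDirac 1 \<star> gen 2 \<star> gen 3 + CDirac 2 \<star> gen 3 \<star> gen 1 + CDirac 3 \<star> gen 1 \<star> gen 2)"
    by (simp add: sum_3 \<omega>_def gen_normalize scaleR_add_right scaleR_diff_right)
  also have "(\<Sum>k\<in>UNIV. xvar k \<star> com Dirac (gen k) \<star> \<omega>) =
    2 *\<^sub>R (ang 1 2 \<star> gen 3 + ang 3 1 \<star> gen 2 + ang 2 3 \<star> gen 1)"
    by (simp add: sum_3 Dirac_sum ang_eq cl_comm_def \<omega>_def gen_normalize scaleR_2 algebra_simps)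
  finally show ?thesis
    unfolding O3_double_CDirac by (simp add: cl_mult_distrib algebra_simps)
qed

lemma O3_omega: "O3 \<star> \<omega> = \<omega> \<star> O3"
proof -
  have "(2 *\<^sub>R O3) \<star> \<omega> = \<omega> \<star> (2 *\<^sub>R O3)"
    unfolding O3_eq by (simp add: cl_comm_def cl_mult_distrib Dirac_omega Xvec_omega omega_mult)
  then show ?thesis by (simp add: cl_mult_distrib)
qed

lemma O3_commute_even:
  assumes "Y \<star> com Dirac Xvec = com Dirac Xvec \<star> Y" "Y \<star> \<omega> = \<omega> \<star> Y"
  shows "Y \<star> O3 = O3 \<star> Y"
proof -
  have "Y \<star> (2 *\<^sub>R O3) = (2 *\<^sub>R O3) \<star> Y"
    unfolding O3_eq using assms mult_tail[OF assms(1)] mult_tail[OF assms(2)]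
    by (simp add: cl_mult_distrib cl_mult_assoc)
  then show ?thesis by (simp add: cl_mult_distrib)
qed

lemma O2_O3: "O2 i j \<star> O3 = O3 \<star> O2 i j"
  by (rule O3_commute_even) (simp_all add: cl_comm_def cl_mult_distrib cl_mult_assoc O2_omega
    O2_Dirac O2_Xvec mult_tail[OF O2_Dirac] mult_tail[OF O2_Xvec])

lemma O1_O3: "O1 i \<star> O3 = O3 \<star> O1 i"
  by (rule O3_commute_even) (simp_all add: cl_comm_def cl_mult_distrib cl_mult_assoc O1_omega
    O1_Dirac O1_Xvec mult_tail[OF O1_Dirac] mult_tail[OF O1_Xvec])

lemma sigma_tilde_omega: "sigma_tilde \<epsilon> \<alpha> \<star> \<omega> = \<omega> \<star> sigma_tilde \<epsilon> \<alpha>"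
  by (simp add: sigma_tilde_eq gen_vec_def omega_mult of_omega cl_mult_sum_left cl_mult_sum_right
    cl_mult_distrib gen_omega)

lemma sigma_tilde_O3:
  assumes "\<alpha> \<in> dih_roots m"
  shows "sigma_tilde \<epsilon> \<alpha> \<star> O3 = O3 \<star> sigma_tilde \<epsilon> \<alpha>"
  by (rule O3_commute_even) (simp_all add: cl_comm_def cl_mult_distrib cl_mult_assoc sigma_tilde_omega
    sigma_tilde_Dirac sigma_tilde_Xvec mult_tail[OF sigma_tilde_Dirac] mult_tail[OF sigma_tilde_Xvec] assms)

section \<open>Commutators of two-index symmetries\<close>

text \<open>
  The two-index symmetries are recovered from the three-index one. Both sides are expanded in
  ordered monomials in the Clifford generators.
\<close>

lemma O2_eq_O3:
  assumes "cyclic i j k"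
  shows "4 *\<^sub>R O2 j k = (2 * \<epsilon>) *\<^sub>R acom O3 (gen i) - 2 *\<^sub>R (CDirac i \<star> \<omega>)"
proof -
  have ne: "j \<noteq> k"
    using assms by (auto simp: cyclic_def)
  have "2 *\<^sub>R (2 *\<^sub>R O2 j k) = \<epsilon> *\<^sub>R acom (2 *\<^sub>R O3) (gen i) - 2 *\<^sub>R (CDirac i \<star> \<omega>)"
    unfolding O3_double_CDirac O2_double_CDirac[OF ne] using assms
    by (auto simp: cyclic_def acom_def CDirac_def sum_3 ang_def CDx_def dunkl_comm_sym \<omega>_def gen_normalize
       scaleR_2 eps_2 scaleR_add_right scaleR_diff_right algebra_simps)
  then show ?thesis by (simp add: acom_def cl_mult_distrib scaleR_add_right mult.commute)
qed

text \<open>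
  Replacing \<open>2\<epsilon> x\<^sub>i\<close> by \<open>{x, e\<^sub>i}\<close>, the formula for \<open>O2 j k\<close> depends on the index only through
  \<open>e\<^sub>i\<close>. The resulting linear map \<open>Psi\<close> is built from \<open>O3\<close>, the Dirac operator, the
  vector variable and \<open>\<omega>\<close>, all of which commute with every \<open>O2 i j\<close>, so the commutator with
  \<open>O2 i j\<close> acts inside its argument.
\<close>

definition Psi where
  "Psi E = (2 * \<epsilon>) *\<^sub>R acom O3 E - \<epsilon> *\<^sub>R (com Dirac (acom Xvec E) \<star> \<omega>)"

lemma linear_Psi: "linear Psi"
  by (rule linearI)
    (simp_all add: Psi_def acom_def cl_comm_def cl_mult_distrib scaleR_add_right scaleR_diff_right mult_ac)

lemma Psi_gen: "cyclic i j k \<Longrightarrow> Psi (gen i) = 4 *\<^sub>R O2 j k"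
  by (simp add: Psi_def O2_eq_O3 acom_Xvec_gen flip: com_Dirac_xvar)
    (simp add: cl_comm_def cl_mult_distrib scaleR_diff_right)

lemma com_O2_Psi: "com (O2 i j) (Psi E) = Psi (com (O2 i j) E)"
proof -
  note c = O2_O3[of i j] O2_Dirac[of i j] O2_Xvec[of i j] O2_omega[of i j]
  show ?thesis
    by (simp add: Psi_def cl_comm_def acom_def cl_mult_distrib cl_mult_assoc c
        mult_tail[OF c(1)] mult_tail[OF c(2)] mult_tail[OF c(3)] mult_tail[OF c(4)] algebra_simps)
qed

lemma Psi_O1: "Psi (O1 i) = (4 * \<epsilon>) *\<^sub>R (O1 i \<star> O3)"
  by (simp add: Psi_def acom_def cl_comm_def O1_Xvec O1_O3 cl_mult_distrib flip: scaleR_2)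

lemma Psi_omega: "Psi (\<omega> \<star> E) = \<omega> \<star> Psi E"
proof -
  note c = O3_omega Dirac_omega Xvec_omega
  show ?thesis
    by (simp add: Psi_def acom_def cl_comm_def cl_mult_distrib cl_mult_assoc
        mult_tail[OF c(1)] mult_tail[OF c(2)] mult_tail[OF c(3)] algebra_simps)
qed

text \<open>
  The difference \<open>{D, [x, e\<^sub>k]} - {[D, x], e\<^sub>k}\<close> equals \<open>[x, {D, e\<^sub>k}]\<close>, which is \<open>2\<epsilon>[x, D\<^sub>k]\<close>, a
  multiple of \<open>[D, x\<^sub>k]\<close>.
\<close>

lemma acom_Dirac_com_Xvec_gen:
  "acom Dirac (com Xvec (gen k)) = acom (com Dirac Xvec) (gen k) - (2 * \<epsilon>) *\<^sub>R gen k - 4 *\<^sub>R O1 k"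
  by (simp add: acom_def cl_comm_def cl_mult_distrib cl_mult_assoc gen_Xvec gen_Dirac mult_tail[OF gen_Xvec]
      mult_tail[OF gen_Dirac] dvar_Xvec algebra_simps)

text \<open>
  \<open>O1 j\<close> can be moved out of \<open>Psi\<close>, since it commutes with \<open>O3\<close> and anticommutes with the Dirac
  operator and the vector variable; each of these anticommutations exchanges commutators and
  anticommutators. The contributions of \<open>O3\<close> then cancel.
\<close>

lemma Psi_com_gen_O1: "Psi (com (gen k) (O1 j)) = (4 * \<epsilon>) *\<^sub>R (com (O1 k) (O1 j) \<star> \<omega>)"
proof -
  note s = O1_O3[of j] O1_Dirac[of j] O1_Xvec[of j] O1_omega[of j]
  have 1: "acom O3 (com (gen k) (O1 j)) = com (acom O3 (gen k)) (O1 j)"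
    by (simp add: acom_def cl_comm_def cl_mult_distrib cl_mult_assoc s mult_tail[OF s(1)] algebra_simps)
  have 2: "com Dirac (acom Xvec (com (gen k) (O1 j))) = com (acom Dirac (com Xvec (gen k))) (O1 j)"
    by (simp add: acom_def cl_comm_def cl_mult_distrib cl_mult_assoc s mult_tail[OF s(2)] mult_tail[OF s(3)] algebra_simps)
  have 3: "acom Dirac (com Xvec (gen k)) \<star> \<omega> = 2 *\<^sub>R acom O3 (gen k) - 4 *\<^sub>R (O1 k \<star> \<omega>)"
  proof -
    have "2 *\<^sub>R acom O3 (gen k) = acom (2 *\<^sub>R O3) (gen k)"
      by (simp add: acom_def cl_mult_distrib scaleR_add_right)
    then show ?thesis
      by (simp add: acom_Dirac_com_Xvec_gen O3_eq)
       (simp add: acom_def cl_mult_distrib cl_mult_assoc gen_omega scaleR_2 eps_2 algebra_simps)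
  qed
  have 4: "com (acom Dirac (com Xvec (gen k))) (O1 j) \<star> \<omega> = com (acom Dirac (com Xvec (gen k)) \<star> \<omega>) (O1 j)"
    by (simp add: cl_comm_def cl_mult_distrib cl_mult_assoc s)
  show ?thesis
    unfolding Psi_def 1 2 4 3
    by (simp add: cl_comm_def cl_mult_distrib cl_mult_assoc s scaleR_diff_right mult_ac)
qed

text \<open>
  The last term is \<open>[e\<^sub>ie\<^sub>j, O1 j]\<close>; this form of it is the one on which \<open>Psi\<close> can be evaluated.
\<close>

lemma com_O2_gen:
  assumes "cyclic i j k"
  shows "com (O2 i j) (gen j) = gen i + (2 * \<epsilon>) *\<^sub>R O1 i + \<epsilon> *\<^sub>R (\<omega> \<star> com (gen k) (O1 j))"
proof -
  have ne: "i \<noteq> j"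
    using assms by (auto simp: cyclic_def)
  note anti = cl_gen_anticommute_distinct[OF ne, of \<epsilon>]
  have K: "acom (O1 p) (gen q) = CDx p q" if "p \<noteq> q" for p q
  proof -
    have "acom (O1 p) (gen q) =
        (\<epsilon> / 2) *\<^sub>R (acom (CDirac p) (gen q) - (gen p \<star> gen q + gen q \<star> gen p))"
      by (simp add: acom_def O1_eq cl_mult_distrib algebra_simps)
    then show ?thesis
      using that by (simp add: acom_CDirac_gen gen_acom)
  qed
  have r: "gen i \<star> O1 j = CDx i j - O1 j \<star> gen i" "gen j \<star> O1 i = CDx i j - O1 i \<star> gen j"
    using K[OF ne] K[OF ne[symmetric]] by (simp_all add: acom_def CDx_sym[of j i] algebra_simps)
  have g: "gen j \<star> (gen i \<star> gen j) = - (\<epsilon> *\<^sub>R gen i)"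
    by (simp add: anti gen_square cl_mult_distrib mult_tail[OF gen_square])
  have C: "gen j \<star> CDx i j = CDx i j \<star> gen j"
    by (simp add: CDx_def gen_of)
  have "\<epsilon> *\<^sub>R (\<omega> \<star> com (gen k) (O1 j)) = com (gen i \<star> gen j) (O1 j)"
    by (simp add: cyclic_gen[OF assms] cl_comm_def cl_mult_distrib O1_omega[of j] cl_mult_assoc
        mult_tail[OF O1_omega] scaleR_diff_right)
  also have "\<dots> = gen j \<star> (O1 j \<star> gen i) - CDx i j \<star> gen j - O1 j \<star> (gen i \<star> gen j)"
    by (simp add: cl_comm_def cl_mult_assoc)
      (simp add: mult_tail[OF anti] cl_mult_distrib cl_mult_assoc r C)
  finally have F: "\<epsilon> *\<^sub>R (\<omega> \<star> com (gen k) (O1 j)) = \<dots>" .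
  show ?thesis
    unfolding F
    by (simp add: sym2_def cl_comm_def cl_mult_distrib cl_mult_assoc gen_square g mult_tail[OF r(2)] gen_of
       algebra_simps flip: scaleR_add_left)
qed

text \<open>
  Since \<open>4 O2 k i = Psi e\<^sub>j\<close>, it suffices to evaluate \<open>Psi\<close> on the three terms of \<open>[O2 i j, e\<^sub>j]\<close>,
  and these give the three terms on the right-hand side.
\<close>

lemma com_O2_O2:
  assumes "cyclic i j k"
  shows "com (O2 i j) (O2 k i) = O2 j k + 2 *\<^sub>R (O1 i \<star> O3) + \<epsilon> *\<^sub>R com (O1 j) (O1 k)"
proof -
  have "4 *\<^sub>R com (O2 i j) (O2 k i) = com (O2 i j) (Psi (gen j))"
    unfolding Psi_gen[OF cyclic_rotate[OF assms]]
    by (simp add: cl_comm_def cl_mult_distrib scaleR_diff_right)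
  also have "\<dots> = Psi (gen i) + (2 * \<epsilon>) *\<^sub>R Psi (O1 i) + \<epsilon> *\<^sub>R (\<omega> \<star> Psi (com (gen k) (O1 j)))"
    unfolding com_O2_Psi com_O2_gen[OF assms]
    by (simp add: linear_add[OF linear_Psi] linear_scale[OF linear_Psi] Psi_omega)
  also have "\<omega> \<star> Psi (com (gen k) (O1 j)) = 4 *\<^sub>R com (O1 j) (O1 k)"
    unfolding Psi_com_gen_O1
    by (simp add: cl_comm_def cl_mult_distrib cl_mult_assoc O1_omega mult_tail[OF O1_omega] omega_square
      mult_tail[OF omega_square] algebra_simps)
  also have "Psi (gen i) + (2 * \<epsilon>) *\<^sub>R Psi (O1 i) + \<epsilon> *\<^sub>R (4 *\<^sub>R com (O1 j) (O1 k)) =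
    4 *\<^sub>R (O2 j k + 2 *\<^sub>R (O1 i \<star> O3) + \<epsilon> *\<^sub>R com (O1 j) (O1 k))"
    by (simp add: Psi_gen[OF assms] Psi_O1 scaleR_add_right)
  finally show ?thesis
    by (rule scaleR_left_imp_eq[rotated]) simp
qed

section \<open>Conjugation of two-index symmetries by reflections\<close>

lemma sigma_tilde_gen_vec:
  assumes "\<alpha> \<in> dih_roots m"
  shows "sigma_tilde \<epsilon> \<alpha> \<star> gen_vec v = - (gen_vec (reflection \<alpha> v) \<star> sigma_tilde \<epsilon> \<alpha>)"
  using sigma_tilde_of_gen_vec[OF dih_roots_unit[OF assms], of 1 1 \<epsilon> v] by simp

text \<open>
  The argument of \<open>Psi\<close> occurs together with either \<open>O3\<close> or both the Dirac operator and the vector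
  variable, so the signs from the two anticommutations cancel.
\<close>

lemma sigma_tilde_Psi:
  assumes "\<alpha> \<in> dih_roots m" and E: "sigma_tilde \<epsilon> \<alpha> \<star> E = F \<star> sigma_tilde \<epsilon> \<alpha>"
  shows "sigma_tilde \<epsilon> \<alpha> \<star> Psi E = Psi F \<star> sigma_tilde \<epsilon> \<alpha>"
proof -
  note c = sigma_tilde_Dirac[OF assms(1)] sigma_tilde_Xvec[OF assms(1)] sigma_tilde_O3[OF assms(1)]
    sigma_tilde_omega[of \<alpha>] E
  show ?thesis
    by (simp add: Psi_def acom_def cl_comm_def cl_mult_distrib cl_mult_assoc c mult_tail[OF c(1)]
        mult_tail[OF c(2)] mult_tail[OF c(3)] mult_tail[OF c(4)] mult_tail[OF c(5)] algebra_simps)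
qed

lemma Psi_gen_vec: "Psi (gen_vec v) = 4 *\<^sub>R (v $ 1 *\<^sub>R O2 2 3 + v $ 2 *\<^sub>R O2 3 1 + v $ 3 *\<^sub>R O2 1 2)"
  by (simp add: gen_vec_def sum_3 linear_add[OF linear_Psi] linear_scale[OF linear_Psi]
      Psi_gen[of 1 2 3] Psi_gen[of 2 3 1] Psi_gen[of 3 1 2] cyclic_def scaleR_add_right mult.commute)

text \<open>
  The two-index symmetries, in the order 23, 31, 12, transform like the coordinate vectors, up to
  the sign with which Clifford vectors transform.
\<close>

lemma sigma_tilde_O2:
  assumes "\<alpha> \<in> dih_roots m" "cyclic i j k"
  shows "sigma_tilde \<epsilon> \<alpha> \<star> O2 j k =
    - ((reflection \<alpha> (axis i 1) $ 1 *\<^sub>R O2 2 3 + reflection \<alpha> (axis i 1) $ 2 *\<^sub>R O2 3 1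
      + reflection \<alpha> (axis i 1) $ 3 *\<^sub>R O2 1 2) \<star> sigma_tilde \<epsilon> \<alpha>)"
proof -
  have "4 *\<^sub>R (sigma_tilde \<epsilon> \<alpha> \<star> O2 j k) = sigma_tilde \<epsilon> \<alpha> \<star> Psi (gen_vec (axis i 1))"
    by (simp add: gen_vec_axis Psi_gen[OF assms(2)] cl_mult_distrib)
  also have "\<dots> = Psi (- gen_vec (reflection \<alpha> (axis i 1))) \<star> sigma_tilde \<epsilon> \<alpha>"
    by (rule sigma_tilde_Psi[OF assms(1)])
      (simp add: sigma_tilde_gen_vec[OF assms(1)] cl_mult_distrib)
  also have "\<dots> = 4 *\<^sub>R - ((reflection \<alpha> (axis i 1) $ 1 *\<^sub>R O2 2 3 + reflection \<alpha> (axis i 1) $ 2 *\<^sub>R O2 3 1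
      + reflection \<alpha> (axis i 1) $ 3 *\<^sub>R O2 1 2) \<star> sigma_tilde \<epsilon> \<alpha>)"
    unfolding linear_neg[OF linear_Psi] Psi_gen_vec
    by (simp only: cl_mult_distrib scaleR_minus_right)
  finally show ?thesis
    by (rule scaleR_left_imp_eq[rotated]) simp
qed

section \<open>Centrality of the three-index symmetry\<close>

lemma O3_W_tilde: "w \<in> W_tilde m \<epsilon> \<Longrightarrow> w \<star> O3 = O3 \<star> w"
proof (induction rule: W_tilde.induct)
  case (mult v w)
  then show ?case by (metis cl_mult_assoc)
next
  case (inverse w v)
  have "v \<star> O3 = v \<star> (O3 \<star> w) \<star> v"
    by (simp add: cl_mult_assoc inverse.hyps)
  also have "\<dots> = O3 \<star> v"
    by (simp add: inverse.IH[symmetric] inverse.hyps flip: cl_mult_assoc)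
  finally show ?case .
qed (simp_all add: sigma_tilde_O3)

lemma O3_sym_algebra: "X \<in> sym_algebra m \<kappa> \<epsilon> \<Longrightarrow> O3 \<star> X = X \<star> O3"
  unfolding sym_algebra_def
proof (induction rule: generated_algebra.induct)
  case (gen X)
  moreover have "O3 \<star> X = X \<star> O3" if "X \<in> group_algebra m \<epsilon>"
    using that by (auto simp: group_algebra_def cl_mult_sum_left cl_mult_sum_right cl_scaleC_mult
      O3_W_tilde subset_iff intro!: sum.cong)
  ultimately show ?case
    by (auto simp: O2_O3)
next
  case (mult X Y)
  then show ?case by (metis cl_mult_assoc)
qed (simp_all add: cl_mult_distrib cl_scaleC_mult)

end

theorem proposition1:
  fixes m :: nat and \<epsilon> :: real and \<kappa> :: "real^3 \<Rightarrow> complex"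
  assumes "m \<ge> 1" and "\<epsilon> \<in> {-1, 1}" and "orbit_invariant m \<kappa>"
  shows
    "(\<forall>X\<in>sym_algebra m \<kappa> \<epsilon>. sym3 m \<kappa> \<epsilon> \<star>\<^bsub>\<epsilon>\<^esub> X = X \<star>\<^bsub>\<epsilon>\<^esub> sym3 m \<kappa> \<epsilon>) \<and>
     (cl_comm \<epsilon> (sym2 m \<kappa> \<epsilon> 1 2) (sym2 m \<kappa> \<epsilon> 3 1) =
        sym2 m \<kappa> \<epsilon> 2 3 + 2 *\<^sub>R (sym1 m \<kappa> \<epsilon> 1 \<star>\<^bsub>\<epsilon>\<^esub> sym3 m \<kappa> \<epsilon>)
        + \<epsilon> *\<^sub>R cl_comm \<epsilon> (sym1 m \<kappa> \<epsilon> 2) (sym1 m \<kappa> \<epsilon> 3)) \<and>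
     (cl_comm \<epsilon> (sym2 m \<kappa> \<epsilon> 2 3) (sym2 m \<kappa> \<epsilon> 1 2) =
        sym2 m \<kappa> \<epsilon> 3 1 + 2 *\<^sub>R (sym1 m \<kappa> \<epsilon> 2 \<star>\<^bsub>\<epsilon>\<^esub> sym3 m \<kappa> \<epsilon>)
        + \<epsilon> *\<^sub>R cl_comm \<epsilon> (sym1 m \<kappa> \<epsilon> 3) (sym1 m \<kappa> \<epsilon> 1)) \<and>
     (cl_comm \<epsilon> (sym2 m \<kappa> \<epsilon> 3 1) (sym2 m \<kappa> \<epsilon> 2 3) =
        sym2 m \<kappa> \<epsilon> 1 2 + 2 *\<^sub>R (sym1 m \<kappa> \<epsilon> 3 \<star>\<^bsub>\<epsilon>\<^esub> sym3 m \<kappa> \<epsilon>)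
        + \<epsilon> *\<^sub>R cl_comm \<epsilon> (sym1 m \<kappa> \<epsilon> 1) (sym1 m \<kappa> \<epsilon> 2)) \<and>
     (sigma_tilde \<epsilon> dih_root0 \<star>\<^bsub>\<epsilon>\<^esub> sym2 m \<kappa> \<epsilon> 1 2 =
        sym2 m \<kappa> \<epsilon> 1 2 \<star>\<^bsub>\<epsilon>\<^esub> sigma_tilde \<epsilon> dih_root0) \<and>
     (sigma_tilde \<epsilon> dih_root0 \<star>\<^bsub>\<epsilon>\<^esub> sym2 m \<kappa> \<epsilon> 3 1 =
        - (sym2 m \<kappa> \<epsilon> 3 1 \<star>\<^bsub>\<epsilon>\<^esub> sigma_tilde \<epsilon> dih_root0)) \<and>
     (sigma_tilde \<epsilon> dih_root0 \<star>\<^bsub>\<epsilon>\<^esub> sym2 m \<kappa> \<epsilon> 2 3 =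
        - (sym2 m \<kappa> \<epsilon> 2 3 \<star>\<^bsub>\<epsilon>\<^esub> sigma_tilde \<epsilon> dih_root0)) \<and>
     (\<forall>j\<in>{1..2 * m}. sigma_tilde \<epsilon> (dih_root m j) \<star>\<^bsub>\<epsilon>\<^esub> sym2 m \<kappa> \<epsilon> 1 2 =
        - (sym2 m \<kappa> \<epsilon> 1 2 \<star>\<^bsub>\<epsilon>\<^esub> sigma_tilde \<epsilon> (dih_root m j))) \<and>
     (\<forall>j\<in>{1..2 * m}. sigma_tilde \<epsilon> (dih_root m j) \<star>\<^bsub>\<epsilon>\<^esub> sym2 m \<kappa> \<epsilon> 3 1 =
        (cos (2 * real j * pi / real m) *\<^sub>R sym2 m \<kappa> \<epsilon> 3 1
         - sin (2 * real j * pi / real m) *\<^sub>R sym2 m \<kappa> \<epsilon> 2 3)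
        \<star>\<^bsub>\<epsilon>\<^esub> sigma_tilde \<epsilon> (dih_root m j)) \<and>
     (\<forall>j\<in>{1..2 * m}. sigma_tilde \<epsilon> (dih_root m j) \<star>\<^bsub>\<epsilon>\<^esub> sym2 m \<kappa> \<epsilon> 2 3 =
        (- sin (2 * real j * pi / real m) *\<^sub>R sym2 m \<kappa> \<epsilon> 3 1
         - cos (2 * real j * pi / real m) *\<^sub>R sym2 m \<kappa> \<epsilon> 2 3)
        \<star>\<^bsub>\<epsilon>\<^esub> sigma_tilde \<epsilon> (dih_root m j))"
proof -
  interpret dihedral_dunkl_dirac m \<epsilon> \<kappa>
    using assms by unfold_locales
  have cyc: "cyclic 1 2 3" "cyclic 2 3 1" "cyclic 3 1 2"
    by (simp_all add: cyclic_def)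
  have rj: "dih_root m j \<in> dih_roots m" if "j \<in> {1..2 * m}" for j
    using that by (auto simp: dih_roots_def)
  have r0: "dih_root0 \<in> dih_roots m"
    by (simp add: dih_roots_def)
  have refl0: "reflection dih_root0 (axis i 1) $ l = (if i = l then if l = 3 then - 1 else 1 else 0)" for i l
    unfolding reflection_unit[OF dih_roots_unit[OF r0]] inner_axis
    using exhaust_3[of i] exhaust_3[of l] by (auto simp: dih_root0_def axis_def)
  have reflj: "reflection (dih_root m j) (axis i 1) $ l =
    axis i 1 $ l - 2 * dih_root m j $ i * dih_root m j $ l" if "j \<in> {1..2 * m}" for i j l
    unfolding reflection_unit[OF dih_roots_unit[OF rj[OF that]]] by (simp add: inner_axis)
  have dbl: "2 * sin (real j * pi / real m) * sin (real j * pi / real m) = 1 - cos (2 * real j * pi / real m)"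
    "2 * cos (real j * pi / real m) * cos (real j * pi / real m) = 1 + cos (2 * real j * pi / real m)"
    "2 * sin (real j * pi / real m) * cos (real j * pi / real m) = sin (2 * real j * pi / real m)"
    "2 * cos (real j * pi / real m) * sin (real j * pi / real m) = sin (2 * real j * pi / real m)" for j
    using sin_double[of "real j * pi / real m"] cos_double[of "real j * pi / real m"]
      sin_cos_squared_add[of "real j * pi / real m"]
    by (auto simp: mult.assoc power2_eq_square)
  note s0 = sigma_tilde_O2[OF r0 cyc(1)] sigma_tilde_O2[OF r0 cyc(2)] sigma_tilde_O2[OF r0 cyc(3)]
  have sj: "sigma_tilde \<epsilon> (dih_root m j) \<star>\<^bsub>\<epsilon>\<^esub> sym2 m \<kappa> \<epsilon> 1 2 =
        - (sym2 m \<kappa> \<epsilon> 1 2 \<star>\<^bsub>\<epsilon>\<^esub> sigma_tilde \<epsilon> (dih_root m j))"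
      "sigma_tilde \<epsilon> (dih_root m j) \<star>\<^bsub>\<epsilon>\<^esub> sym2 m \<kappa> \<epsilon> 3 1 =
        (cos (2 * real j * pi / real m) *\<^sub>R sym2 m \<kappa> \<epsilon> 3 1
         - sin (2 * real j * pi / real m) *\<^sub>R sym2 m \<kappa> \<epsilon> 2 3)
        \<star>\<^bsub>\<epsilon>\<^esub> sigma_tilde \<epsilon> (dih_root m j)"
      "sigma_tilde \<epsilon> (dih_root m j) \<star>\<^bsub>\<epsilon>\<^esub> sym2 m \<kappa> \<epsilon> 2 3 =
        (- sin (2 * real j * pi / real m) *\<^sub>R sym2 m \<kappa> \<epsilon> 3 1
         - cos (2 * real j * pi / real m) *\<^sub>R sym2 m \<kappa> \<epsilon> 2 3)
        \<star>\<^bsub>\<epsilon>\<^esub> sigma_tilde \<epsilon> (dih_root m j)" if j: "j \<in> {1..2 * m}" for j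
    unfolding sigma_tilde_O2[OF rj[OF j] cyc(1)] sigma_tilde_O2[OF rj[OF j] cyc(2)] sigma_tilde_O2[OF rj[OF j] cyc(3)]
      reflj[OF j]
    by (simp_all add: dih_root_def axis_def dbl cl_mult_distrib)
  show ?thesis
    using com_O2_O2[OF cyc(1)] com_O2_O2[OF cyc(2)] com_O2_O2[OF cyc(3)] O3_sym_algebra sj s0
    by (simp add: refl0 cl_mult_distrib)
qed

end
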